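(* Let $k$ be a field, let $m\ge 3$ and $s\ge 2$ be integers, and let $R=k[x_1,\dots,x_m]$. Let $G=K_m$ be the complete graph on $\{x_1,\dots,x_m\}$ and $H=K_{m-1}$ its induced subgraph on $\{x_1,\dots,x_{m-1}\}$. Put $$I_{H,s}=\langle w\in\mathcal G(I(G)^{(s)}) : x_m\nmid w\rangle,\qquad I_{G\setminus H,s}=I(G)^{(s)}\cap\langle x_m\rangle .$$ Then $I(G)^{(s)}=I_{H,s}+I_{G\setminus H,s}$ is an Eliahou-Kervaire splitting.
   Context: The edge ideal of a finite simple graph $G$ with vertex set $\{x_1,\dots,x_m\}$ is $I(G)=\langle x_ix_j:\{x_i,x_j\}\in E(G)\rangle\subset R$. Symbolic powers: for a monomial ideal $I\subset R$ with primary decomposition $I=I_1\cap\dots\cap I_n$, and $Q$ an associated prime of $I$ maximal under inclusion, put $I_{\subseteq Q}=\bigcap_{\sqrt{I_\ell}\subseteq Q}I_\ell$; then $I^{(s)}=\bigcap_{Q}I_{\subseteq Q}^s$, the intersection running over all associated primes $Q$ of $I$ that are maximal with respect to inclusion. $\mathcal G(I)$ denotes the (unique) set of minimal monomial generators of a monomial ideal $I$. Eliahou-Kervaire splitting: let $I,J,K$ be monomial ideals of $R$ such that $\mathcal G(I)$ is the disjoint union of $\mathcal G(J)$ and $\mathcal G(K)$. Then $I=J+K$ is an Eliahou-Kervaire splitting if there is a function $\mathcal G(J\cap K)\to\mathcal G(J)\times\mathcal G(K)$, $w\mapsto(\phi(w),\varphi(w))$, such that (1) $w=\mathrm{lcm}(\phi(w),\varphi(w))$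 for all $w\in\mathcal G(J\cap K)$; and (2) for every nonempty subset $S\subseteq\mathcal G(J\cap K)$, both $\mathrm{lcm}(\phi(S))$ and $\mathrm{lcm}(\varphi(S))$ strictly divide $\mathrm{lcm}(S)$ (i.e. divide it and are not equal to it). *)

theory Defs
  imports
    "HOL-Library.Poly_Mapping"
    "HOL-Algebra.Ideal_Product"
    "HOL-Algebra.Algebraic_Closure_Type"
begin

section \<open>Symbolic powers of ideals\<close>

definition radical_ideal :: "('a, 'b) ring_scheme \<Rightarrow> 'a set \<Rightarrow> 'a set" where
  "radical_ideal R I = {a \<in> carrier R. \<exists>n::nat. a [^]\<^bsub>R\<^esub> n \<in> I}"

definition primary_ideal :: "('a, 'b) ring_scheme \<Rightarrow> 'a set \<Rightarrow> bool" where
  "primary_ideal R Q \<longleftrightarrow> ideal Q R \<and> Q \<noteq> carrier R \<and>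
     (\<forall>a\<in>carrier R. \<forall>b\<in>carrier R. a \<otimes>\<^bsub>R\<^esub> b \<in> Q \<longrightarrow> a \<in> Q \<or> b \<in> radical_ideal R Q)"

(* Intersections are taken inside carrier R, so the empty one is the unit ideal. *)
definition primary_decomposition :: "('a, 'b) ring_scheme \<Rightarrow> 'a set set \<Rightarrow> 'a set \<Rightarrow> bool" where
  "primary_decomposition R D I \<longleftrightarrow>
     finite D \<and> (\<forall>q\<in>D. primary_ideal R q) \<and> I = carrier R \<inter> \<Inter>D"

(* The associated primes of R/I, i.e. the prime ideals of the form (I : f). *)
definition associated_primes :: "('a, 'b) ring_scheme \<Rightarrow> 'a set \<Rightarrow> 'a set set" where
  "associated_primes R I =
     {P. primeideal P R \<and> (\<exists>f\<in>carrier R. P = {g \<in> carrier R. g \<otimes>\<^bsub>R\<^esub> f \<in> I})}"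

definition maximal_associated_primes :: "('a, 'b) ring_scheme \<Rightarrow> 'a set \<Rightarrow> 'a set set" where
  "maximal_associated_primes R I =
     {Q \<in> associated_primes R I. \<forall>P\<in>associated_primes R I. Q \<subseteq> P \<longrightarrow> P = Q}"

(* The intersection of the components whose radical lies in the prime Q is the contraction
   of the extension of I to the localisation at Q; it does not depend on the primary
   decomposition D, so the description below determines it uniquely whenever I has one. *)
definition primary_part_within :: "('a, 'b) ring_scheme \<Rightarrow> 'a set \<Rightarrow> 'a set \<Rightarrow> 'a set" where
  "primary_part_within R I Q =
     (THE J. \<exists>D. primary_decomposition R D I \<and>
                 J = carrier R \<inter> \<Inter>{q \<in> D. radical_ideal R q \<subseteq> Q})"

definition symbolic_power :: "('a, 'b) ring_scheme \<Rightarrow> 'a set \<Rightarrow> nat \<Rightarrow> 'a set" where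
  "symbolic_power R I s =
     carrier R \<inter>
     (\<Inter>Q\<in>maximal_associated_primes R I. primary_part_within R I Q [^]\<^bsub>ideals_set R\<^esub> s)"


section \<open>Monomial ideals in a polynomial ring over a field\<close>

(* Polynomials over 'k with one variable for each element of the finite type 'n:
   a polynomial maps exponent vectors to coefficients. *)
type_synonym ('n, 'k) mpoly = "('n \<Rightarrow>\<^sub>0 nat) \<Rightarrow>\<^sub>0 'k"

abbreviation mpoly_ring :: "('n::finite, 'k::field) mpoly ring" where
  "mpoly_ring \<equiv> ring_of_type_algebra"

definition mvar :: "'n \<Rightarrow> ('n::finite, 'k::field) mpoly" where
  "mvar i = Poly_Mapping.single (Poly_Mapping.single i 1) 1"

definition monomials :: "('n::finite, 'k::field) mpoly set" where
  "monomials = range (\<lambda>a. Poly_Mapping.single a 1)"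

definition monomial_ideal :: "('n::finite, 'k::field) mpoly set \<Rightarrow> bool" where
  "monomial_ideal I \<longleftrightarrow> (\<exists>A \<subseteq> monomials. I = Idl\<^bsub>mpoly_ring\<^esub> A)"

(* Every monomial ideal has exactly one generating set that consists of monomials and is
   minimal under inclusion. *)
definition min_gens :: "('n::finite, 'k::field) mpoly set \<Rightarrow> ('n, 'k) mpoly set" where
  "min_gens I =
     (THE A. A \<subseteq> monomials \<and> Idl\<^bsub>mpoly_ring\<^esub> A = I \<and> (\<forall>B. B \<subset> A \<longrightarrow> Idl\<^bsub>mpoly_ring\<^esub> B \<noteq> I))"

(* Only meaningful when S has a common multiple, in particular for finite S; sets of minimal
   generators are finite by Dickson's lemma. *)
definition monomial_lcm :: "('n::finite, 'k::field) mpoly set \<Rightarrow> ('n, 'k) mpoly" where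
  "monomial_lcm S =
     (THE w. w \<in> monomials \<and> (\<forall>u\<in>S. u dvd w) \<and>
             (\<forall>v\<in>monomials. (\<forall>u\<in>S. u dvd v) \<longrightarrow> w dvd v))"

definition strictly_divides :: "'a::comm_monoid_mult \<Rightarrow> 'a \<Rightarrow> bool" where
  "strictly_divides u w \<longleftrightarrow> u dvd w \<and> u \<noteq> w"

definition EK_splitting ::
  "('n::finite, 'k::field) mpoly set \<Rightarrow> ('n, 'k) mpoly set \<Rightarrow> ('n, 'k) mpoly set \<Rightarrow> bool" where
  "EK_splitting I J K \<longleftrightarrow>
     monomial_ideal I \<and> monomial_ideal J \<and> monomial_ideal K \<and>
     min_gens I = min_gens J \<union> min_gens K \<and> min_gens J \<inter> min_gens K = {} \<and>
     I = J <+>\<^bsub>mpoly_ring\<^esub> K \<and>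
     (\<exists>\<phi> \<psi>.
        (\<forall>w\<in>min_gens (J \<inter> K). \<phi> w \<in> min_gens J \<and> \<psi> w \<in> min_gens K) \<and>
        (\<forall>w\<in>min_gens (J \<inter> K). w = monomial_lcm {\<phi> w, \<psi> w}) \<and>
        (\<forall>S. S \<noteq> {} \<and> S \<subseteq> min_gens (J \<inter> K) \<longrightarrow>
           strictly_divides (monomial_lcm (\<phi> ` S)) (monomial_lcm S) \<and>
           strictly_divides (monomial_lcm (\<psi> ` S)) (monomial_lcm S)))"


section \<open>Edge ideals\<close>

(* A simple graph whose vertices are the elements of 'n is given by its set of edges,
   each edge being a two-element set. *)
definition complete_graph_edges :: "'v set \<Rightarrow> 'v set set" where
  "complete_graph_edges V = {{u, v} | u v. u \<in> V \<and> v \<in> V \<and> u \<noteq> v}"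

definition edge_ideal :: "'n::finite set set \<Rightarrow> ('n, 'k::field) mpoly set" where
  "edge_ideal E = Idl\<^bsub>mpoly_ring\<^esub> {mvar i * mvar j | i j. {i, j} \<in> E}"

end

theory Submission
  imports Defs "HOL-Computational_Algebra.Formal_Power_Series"
begin

text \<open>
  The edge ideal of the complete graph is the intersection of the incomparable primes
  \<open>P\<^sub>i = \<langle>x\<^sub>j : j \<noteq> i\<rangle>\<close>.  For such an intersection the associated primes are the given
  primes, all of them maximal, and the part of the ideal inside \<open>P\<^sub>i\<close> is \<open>P\<^sub>i\<close> itself
  (\<open>symbolic_power_Inter_primes\<close>).  So the symbolic power is the intersection of the powers
  \<open>P\<^sub>i\<^sup>s\<close>, and it is spanned by the monomials \<open>x\<^sup>a\<close> with \<open>s + a\<^sub>i \<le> |a|\<close> for all \<open>i\<close>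
  (\<open>symbolic_power_complete_graph\<close>).  From there on everything concerns the
  exponent vectors satisfying these inequalities, called admissible below.

  Call a coordinate \<open>i\<close> of an admissible vector tight when \<open>s + a\<^sub>i = |a|\<close>; its entry is then a largest
  one.  The minimal generators are the admissible vectors with at least two tight
  coordinates (\<open>minimal_symbolic_exps_iff\<close>): lowering the only tight coordinate, or any positive
  coordinate when there is none, keeps every inequality, whereas two tight coordinates cannot both drop by
  the amount by which the total degree drops.

  Write \<open>z\<close> for the variable that is split off.  The minimal generators of the intersection of
  the two summands have the form \<open>u x\<^sub>z\<close>, where \<open>u\<close> is a minimal generator free of \<open>x\<^sub>z\<close>.
  The splitting function sends \<open>u x\<^sub>z\<close> to \<open>u\<close> and to a minimal generator \<open>v\<close> that contains
  \<open>x\<^sub>z\<close> once, divides \<open>u x\<^sub>z\<close>, and has one factor \<open>x\<^sub>c\<close> fewer than \<open>u\<close>, where \<open>x\<^sub>c\<close> is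
  the first variable dividing \<open>u\<close> in a fixed order.  Such a \<open>v\<close> is \<open>u x\<^sub>z / x\<^sub>c\<close>, except when
  the tight coordinates of \<open>u\<close> are just \<open>c\<close> and one other \<open>d\<close>; then it is
  \<open>u x\<^sub>z / (x\<^sub>c x\<^sub>d)\<close> (\<open>minimal_symbolic_exps_exchange\<close>).

  Strictness of the two divisibilities, for a nonempty set \<open>S\<close> of such generators, follows by
  exhibiting one coordinate in which every member that involves it has been lowered.  For the
  first component this is \<open>z\<close>.  For the second it is the first variable \<open>x\<^sub>c\<close> occurring in
  any of the \<open>u\<close>: whenever \<open>x\<^sub>c\<close> divides some \<open>u\<close> from \<open>S\<close>, it is also the first variable of that \<open>u\<close>.
\<close>

section \<open>Symbolic powers of an intersection of incomparable primes\<close>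

context cring
begin

text \<open>
  Choose in each ideal an element outside the prime; by primality their product stays outside,
  and it lies in every one of the ideals.
\<close>

lemma prime_avoids_finite_Inter:
  assumes P: "primeideal P R" and "finite D"
    and "\<And>q. q \<in> D \<Longrightarrow> ideal q R" and "\<And>q. q \<in> D \<Longrightarrow> \<not> q \<subseteq> P"
  shows "\<exists>g\<in>carrier R. g \<notin> P \<and> (\<forall>q\<in>D. g \<in> q)"
  using assms(2-)
proof (induction D rule: finite_induct)
  case empty
  have "\<one> \<notin> P"
    using P by (metis ideal.one_imp_carrier primeideal.I_notcarr primeideal.axioms(1))
  then show ?case by auto
next
  case (insert q D)
  then obtain g where g: "g \<in> carrier R" "g \<notin> P" "\<forall>q\<in>D. g \<in> q" by auto
  have q: "ideal q R" and "\<not> q \<subseteq> P" using insert.prems by auto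
  then obtain h where h: "h \<in> q" "h \<notin> P" by blast
  have hc: "h \<in> carrier R" using h q by (meson ideal.Icarr)
  have "g \<otimes> h \<notin> P" using primeideal.I_prime[OF P g(1) hc] g(2) h(2) by blast
  moreover have "g \<otimes> h \<in> q" using ideal.I_l_closed[OF q h(1) g(1)] .
  moreover have "\<forall>q\<in>D. g \<otimes> h \<in> q" using g(3) insert.prems hc by (meson ideal.I_r_closed insertCI)
  ultimately show ?case using g(1) hc by blast
qed

lemma radical_subset_prime_iff:
  assumes q: "ideal q R" and P: "primeideal P R"
  shows "radical_ideal R q \<subseteq> P \<longleftrightarrow> q \<subseteq> P"
proof
  have "q \<subseteq> radical_ideal R q"
  proof
    fix a assume "a \<in> q"
    moreover from this have "a \<in> carrier R" using q by (meson ideal.Icarr)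
    ultimately have "a [^] (1::nat) \<in> q" by simp
    then show "a \<in> radical_ideal R q" using \<open>a \<in> carrier R\<close> unfolding radical_ideal_def by blast
  qed
  then show "radical_ideal R q \<subseteq> P \<Longrightarrow> q \<subseteq> P" by blast
next
  assume sub: "q \<subseteq> P"
  have one: "\<one> \<notin> P"
    using P by (metis ideal.one_imp_carrier primeideal.I_notcarr primeideal.axioms(1))
  have "a \<in> P" if "a \<in> carrier R" "a [^] n \<in> P" for a and n :: nat
    using that
  proof (induction n)
    case 0
    then show ?case using one by simp
  next
    case (Suc n)
    then have "a [^] n \<otimes> a \<in> P" by simp
    then show ?case using primeideal.I_prime[OF P, of "a [^] n" a] Suc by auto
  qed
  then show "radical_ideal R q \<subseteq> P" unfolding radical_ideal_def using sub by blast
qed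

text \<open>
  Both sides describe the contraction of the extension of the ideal to the localisation at \<open>P\<close>.
  The right-hand side does not mention the decomposition, so the left-hand side is the same for
  all of them; this is what makes the definite description in the definition of the primary
  part meaningful.  The components whose radical is not inside \<open>P\<close> contain a common multiplier
  outside \<open>P\<close>, and the others are saturated with respect to the complement of \<open>P\<close>.
\<close>

lemma primary_components_within_prime:
  assumes D: "primary_decomposition R D I" and P: "primeideal P R"
  shows "carrier R \<inter> \<Inter>{q \<in> D. radical_ideal R q \<subseteq> P}
       = {f \<in> carrier R. \<exists>g\<in>carrier R - P. g \<otimes> f \<in> I}"
proof (intro equalityI subsetI)
  have fin: "finite D" and prim: "\<And>q. q \<in> D \<Longrightarrow> primary_ideal R q" and I: "I = carrier R \<inter> \<Inter>D"
    using D unfolding primary_decomposition_def by auto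
  have id: "ideal q R" if "q \<in> D" for q using prim[OF that] unfolding primary_ideal_def by simp
  fix f
  {
    assume f: "f \<in> carrier R \<inter> \<Inter>{q \<in> D. radical_ideal R q \<subseteq> P}"
    have "\<exists>g\<in>carrier R. g \<notin> P \<and> (\<forall>q\<in>{q \<in> D. \<not> radical_ideal R q \<subseteq> P}. g \<in> q)"
      by (rule prime_avoids_finite_Inter[OF P])
        (use fin id radical_subset_prime_iff[OF id P] in \<open>(simp; fail) | blast\<close>)+
    then obtain g where g: "g \<in> carrier R" "g \<notin> P" "\<forall>q\<in>{q \<in> D. \<not> radical_ideal R q \<subseteq> P}. g \<in> q"
      by blast
    have "g \<otimes> f \<in> q" if "q \<in> D" for q
    proof (cases "radical_ideal R q \<subseteq> P")
      case True
      then show ?thesis using f that g(1) ideal.I_l_closed[OF id[OF that]] by blast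
    next
      case False
      then show ?thesis using f that g(3) ideal.I_r_closed[OF id[OF that]] by blast
    qed
    then have "g \<otimes> f \<in> I" using I g(1) f by auto
    then show "f \<in> {f \<in> carrier R. \<exists>g\<in>carrier R - P. g \<otimes> f \<in> I}" using f g by auto
  }
  {
    assume "f \<in> {f \<in> carrier R. \<exists>g\<in>carrier R - P. g \<otimes> f \<in> I}"
    then obtain g where f: "f \<in> carrier R" and g: "g \<in> carrier R" "g \<notin> P" "g \<otimes> f \<in> I" by blast
    have "f \<in> q" if q: "q \<in> D" "radical_ideal R q \<subseteq> P" for q
    proof -
      have "f \<otimes> g \<in> q" using g I q(1) f m_comm by auto
      then have "f \<in> q \<or> g \<in> radical_ideal R q"
        using prim[OF q(1)] f g(1) unfolding primary_ideal_def by blast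
      then show ?thesis using g(2) q(2) by blast
    qed
    then show "f \<in> carrier R \<inter> \<Inter>{q \<in> D. radical_ideal R q \<subseteq> P}" using f by blast
  }
qed

lemma primary_part_within_eq:
  assumes D: "primary_decomposition R D I" and P: "primeideal P R"
  shows "primary_part_within R I P = carrier R \<inter> \<Inter>{q \<in> D. radical_ideal R q \<subseteq> P}"
  unfolding primary_part_within_def
  using D primary_components_within_prime[OF _ P] by (intro the_equality) blast+

lemma prime_is_primary:
  assumes "primeideal P R" shows "primary_ideal R P"
proof -
  have "b \<in> radical_ideal R P" if "b \<in> P" for b
  proof -
    have "b \<in> carrier R" using that assms by (meson ideal.Icarr primeideal.axioms(1))
    then have "b [^] (1::nat) \<in> P" using that by simp
    then show ?thesis using \<open>b \<in> carrier R\<close> unfolding radical_ideal_def by blast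
  qed
  then show ?thesis
    using primeideal.axioms(1)[OF assms] primeideal.I_notcarr[OF assms] primeideal.I_prime[OF assms]
    unfolding primary_ideal_def by blast
qed

text \<open>
  The colon ideal of \<open>f\<close> is the intersection of the primes of \<open>D\<close> that avoid \<open>f\<close>.  If it is
  prime it must contain, hence equal, one of these.  Conversely, incomparability gives an \<open>f\<close>
  outside one chosen prime and inside all the others, and its colon ideal is the chosen prime.
\<close>

lemma associated_primes_Inter_primes:
  assumes fin: "finite D" and prime: "\<And>P. P \<in> D \<Longrightarrow> primeideal P R"
    and anti: "\<And>P Q. P \<in> D \<Longrightarrow> Q \<in> D \<Longrightarrow> P \<subseteq> Q \<Longrightarrow> P = Q"
  shows "associated_primes R (carrier R \<inter> \<Inter>D) = D"
proof (intro equalityI subsetI)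
  have id: "ideal Q R" if "Q \<in> D" for Q using prime[OF that] by (simp add: primeideal.axioms(1))
  fix P
  {
    assume "P \<in> associated_primes R (carrier R \<inter> \<Inter>D)"
    then obtain f where P: "primeideal P R" and f: "f \<in> carrier R"
      and eq: "P = {g \<in> carrier R. g \<otimes> f \<in> carrier R \<inter> \<Inter>D}"
      unfolding associated_primes_def by blast
    have "\<exists>Q\<in>{Q \<in> D. f \<notin> Q}. Q \<subseteq> P"
    proof (rule ccontr)
      assume not: "\<not> ?thesis"
      have "\<exists>g\<in>carrier R. g \<notin> P \<and> (\<forall>Q\<in>{Q \<in> D. f \<notin> Q}. g \<in> Q)"
        by (rule prime_avoids_finite_Inter[OF P])
          (use fin id not in \<open>(simp; fail) | blast\<close>)+
      then obtain g where g: "g \<in> carrier R" "g \<notin> P" "\<forall>Q\<in>{Q \<in> D. f \<notin> Q}. g \<in> Q"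
        by blast
      have "g \<otimes> f \<in> Q" if "Q \<in> D" for Q
        using g(1,3) f that id[OF that] by (cases "f \<in> Q") (auto intro: ideal.I_l_closed ideal.I_r_closed)
      then have "g \<in> P" using eq g(1) f by auto
      then show False using g(2) by blast
    qed
    then obtain Q where Q: "Q \<in> D" "f \<notin> Q" "Q \<subseteq> P" by blast
    have "P \<subseteq> Q" using eq Q(1,2) primeideal.I_prime[OF prime[OF Q(1)]] f by auto
    then show "P \<in> D" using Q by simp
  }
  {
    assume P: "P \<in> D"
    have "\<exists>f\<in>carrier R. f \<notin> P \<and> (\<forall>Q\<in>D - {P}. f \<in> Q)"
      by (rule prime_avoids_finite_Inter[OF prime[OF P]])
        (use fin id anti[OF _ P] in \<open>(simp; fail) | blast\<close>)+
    then obtain f where f: "f \<in> carrier R" "f \<notin> P" "\<forall>Q\<in>D - {P}. f \<in> Q"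
      by blast
    have "P = {g \<in> carrier R. g \<otimes> f \<in> carrier R \<inter> \<Inter>D}"
    proof (intro equalityI subsetI)
      fix g assume g: "g \<in> P"
      then have gc: "g \<in> carrier R" using id[OF P] by (meson ideal.Icarr)
      have "g \<otimes> f \<in> Q" if "Q \<in> D" for Q
        using g gc f that id[OF that] by (cases "Q = P") (auto intro: ideal.I_l_closed ideal.I_r_closed)
      then show "g \<in> {g \<in> carrier R. g \<otimes> f \<in> carrier R \<inter> \<Inter>D}" using gc f(1) by auto
    next
      fix g assume "g \<in> {g \<in> carrier R. g \<otimes> f \<in> carrier R \<inter> \<Inter>D}"
      then show "g \<in> P" using primeideal.I_prime[OF prime[OF P], of g f] f P by auto
    qed
    then show "P \<in> associated_primes R (carrier R \<inter> \<Inter>D)"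
      using prime[OF P] f(1) unfolding associated_primes_def by blast
  }
qed

text \<open>
  The family \<open>D\<close> is its own primary decomposition, and by incomparability the only component
  inside \<open>P\<close> is \<open>P\<close>.
\<close>

theorem symbolic_power_Inter_primes:
  assumes fin: "finite D" and prime: "\<And>P. P \<in> D \<Longrightarrow> primeideal P R"
    and anti: "\<And>P Q. P \<in> D \<Longrightarrow> Q \<in> D \<Longrightarrow> P \<subseteq> Q \<Longrightarrow> P = Q"
  shows "symbolic_power R (carrier R \<inter> \<Inter>D) s = carrier R \<inter> (\<Inter>P\<in>D. P [^]\<^bsub>ideals_set R\<^esub> s)"
proof -
  have id: "ideal Q R" if "Q \<in> D" for Q using prime[OF that] by (simp add: primeideal.axioms(1))
  have ass: "associated_primes R (carrier R \<inter> \<Inter>D) = D"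
    by (rule associated_primes_Inter_primes) (fact fin prime anti)+
  have max: "maximal_associated_primes R (carrier R \<inter> \<Inter>D) = D"
    unfolding maximal_associated_primes_def ass by (auto dest: anti)
  have decomp: "primary_decomposition R D (carrier R \<inter> \<Inter>D)"
    unfolding primary_decomposition_def using fin prime prime_is_primary by blast
  have "primary_part_within R (carrier R \<inter> \<Inter>D) P = P" if P: "P \<in> D" for P
  proof -
    have "{q \<in> D. radical_ideal R q \<subseteq> P} = {q \<in> D. q \<subseteq> P}"
      using radical_subset_prime_iff[OF id prime[OF P]] by auto
    also have "\<dots> = {P}" using P by (auto dest: anti)
    finally have "{q \<in> D. radical_ideal R q \<subseteq> P} = {P}" .
    moreover have "P \<subseteq> carrier R" using id[OF P] by (meson ideal.Icarr subsetI)
    ultimately show ?thesis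
      using primary_part_within_eq[OF decomp prime[OF P]] by auto
  qed
  then show ?thesis unfolding symbolic_power_def max by auto
qed

end

section \<open>Exponent vectors under divisibility\<close>

abbreviation lookup :: "('a \<Rightarrow>\<^sub>0 'b::zero) \<Rightarrow> 'a \<Rightarrow> 'b" where
  "lookup \<equiv> Poly_Mapping.lookup"

text \<open>
  This is divisibility of monomials.  It is a separate constant because the order that the
  library puts on \<^typ>\<open>'n \<Rightarrow>\<^sub>0 nat\<close> is lexicographic.
\<close>

definition exp_le :: "('n \<Rightarrow>\<^sub>0 nat) \<Rightarrow> ('n \<Rightarrow>\<^sub>0 nat) \<Rightarrow> bool" where
  "exp_le a b \<longleftrightarrow> (\<forall>i. lookup a i \<le> lookup b i)"

definition total_degree :: "('n::finite \<Rightarrow>\<^sub>0 nat) \<Rightarrow> nat" where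
  "total_degree a = (\<Sum>i\<in>UNIV. lookup a i)"

definition unit_exp :: "'n \<Rightarrow> 'n \<Rightarrow>\<^sub>0 nat" where
  "unit_exp i = Poly_Mapping.single i 1"

definition up_closure :: "('n::finite \<Rightarrow>\<^sub>0 nat) set \<Rightarrow> ('n \<Rightarrow>\<^sub>0 nat) set" where
  "up_closure A = {b. \<exists>a\<in>A. exp_le a b}"

definition minimal_exps :: "('n::finite \<Rightarrow>\<^sub>0 nat) set \<Rightarrow> ('n \<Rightarrow>\<^sub>0 nat) set" where
  "minimal_exps U = {a \<in> U. \<forall>b\<in>U. exp_le b a \<longrightarrow> b = a}"

lemma exp_le_refl [simp]: "exp_le a a"
  by (simp add: exp_le_def)

lemma exp_le_trans: "exp_le a b \<Longrightarrow> exp_le b c \<Longrightarrow> exp_le a c"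
  unfolding exp_le_def by (meson le_trans)

lemma exp_le_antisym: "exp_le a b \<Longrightarrow> exp_le b a \<Longrightarrow> a = b"
  unfolding exp_le_def by (intro poly_mapping_eqI) (meson le_antisym)

lemma exp_le_add: "exp_le a (a + b)" "exp_le a (b + a)"
  by (simp_all add: exp_le_def lookup_add)

lemma exp_le_add_diff: "exp_le a b \<Longrightarrow> a + (b - a) = b"
  by (intro poly_mapping_eqI) (simp add: exp_le_def lookup_add lookup_minus)

lemma exp_le_diff: "exp_le (a - b) a"
  by (simp add: exp_le_def lookup_minus)

lemma lookup_unit_exp: "lookup (unit_exp i) j = (if i = j then 1 else 0)"
  by (simp add: unit_exp_def lookup_single when_def)

lemma unit_exp_le_iff: "exp_le (unit_exp i) b \<longleftrightarrow> 1 \<le> lookup b i"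
  unfolding exp_le_def lookup_unit_exp by (metis zero_le)

lemma total_degree_add [simp]: "total_degree (a + b) = total_degree a + total_degree b"
  by (simp add: total_degree_def lookup_add sum.distrib)

lemma total_degree_unit_exp [simp]: "total_degree (unit_exp i) = 1"
  by (simp add: total_degree_def lookup_unit_exp)

lemma total_degree_split: "total_degree a = lookup a i + (\<Sum>j\<in>UNIV - {i}. lookup a j)"
  by (simp add: total_degree_def sum.remove)

lemma lookup2_le_total_degree:
  assumes "i \<noteq> j" shows "lookup a i + lookup a j \<le> total_degree a"
proof -
  have "(\<Sum>l\<in>{i, j}. lookup a l) \<le> total_degree a"
    unfolding total_degree_def by (rule sum_mono2) auto
  then show ?thesis using assms by simp
qed

lemma Suc_lookup_le_total_degree_iff:
  "1 + lookup a i \<le> total_degree a \<longleftrightarrow> (\<exists>j. j \<noteq> i \<and> 1 \<le> lookup a j)"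
proof -
  have "1 \<le> (\<Sum>j\<in>UNIV - {i}. lookup a j) \<longleftrightarrow> (\<exists>j. j \<noteq> i \<and> 1 \<le> lookup a j)"
    by (auto simp: Suc_le_eq sum_eq_0_iff simp flip: neq0_conv)
  then show ?thesis by (simp add: total_degree_split[of a i])
qed

lemma total_degree_diff_unit:
  assumes "1 \<le> lookup a i" shows "total_degree (a - unit_exp i) = total_degree a - 1"
  using arg_cong[OF exp_le_add_diff[of "unit_exp i" a], of total_degree] assms
  by (simp add: unit_exp_le_iff)

lemma exp_le_total_degree_less:
  assumes "exp_le a b" "a \<noteq> b" shows "total_degree a < total_degree b"
proof -
  have "b - a \<noteq> 0" using assms exp_le_add_diff[of a b] by auto
  then obtain i where "lookup (b - a) i \<noteq> 0" by (metis lookup_zero poly_mapping_eqI)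
  then have "total_degree (b - a) \<noteq> 0" by (simp add: total_degree_split[of _ i])
  then show ?thesis using exp_le_add_diff[OF assms(1)] by (metis less_add_same_cancel1 neq0_conv total_degree_add)
qed

lemma minimal_exps_in: "a \<in> minimal_exps U \<Longrightarrow> a \<in> U"
  by (simp add: minimal_exps_def)

lemma minimal_exps_eq: "a \<in> minimal_exps U \<Longrightarrow> b \<in> U \<Longrightarrow> exp_le b a \<Longrightarrow> b = a"
  by (simp add: minimal_exps_def)

lemma minimal_expsI:
  assumes "a \<in> U" and "\<And>b. b \<in> U \<Longrightarrow> exp_le b a \<Longrightarrow> b = a"
  shows "a \<in> minimal_exps U"
  using assms unfolding minimal_exps_def by blast

lemma minimal_exps_below:
  assumes "b \<in> U" shows "\<exists>a\<in>minimal_exps U. exp_le a b"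
  using assms
proof (induction "total_degree b" arbitrary: b rule: less_induct)
  case less
  show ?case
  proof (cases "b \<in> minimal_exps U")
    case False
    then obtain c where "c \<in> U" "exp_le c b" "c \<noteq> b"
      using less.prems unfolding minimal_exps_def by blast
    then show ?thesis using less.hyps exp_le_total_degree_less exp_le_trans by blast
  next
    case True
    then show ?thesis using exp_le_refl by blast
  qed
qed

lemma up_closure_up_closed: "a \<in> up_closure A \<Longrightarrow> exp_le a b \<Longrightarrow> b \<in> up_closure A"
  unfolding up_closure_def using exp_le_trans by blast

lemma up_closure_superset: "A \<subseteq> up_closure A"
  unfolding up_closure_def using exp_le_refl by blast

lemma up_closure_of_up_closed:
  assumes "\<And>a b. a \<in> U \<Longrightarrow> exp_le a b \<Longrightarrow> b \<in> U" shows "up_closure U = U"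
  using assms up_closure_superset unfolding up_closure_def by blast

lemma up_closure_minimal_exps:
  assumes "\<And>a b. a \<in> U \<Longrightarrow> exp_le a b \<Longrightarrow> b \<in> U" shows "up_closure (minimal_exps U) = U"
  using assms minimal_exps_below[of _ U] unfolding up_closure_def minimal_exps_def by blast

lemma minimal_exps_subset_generators: "minimal_exps (up_closure A) \<subseteq> A"
  using up_closure_superset[of A] unfolding minimal_exps_def up_closure_def by blast

text \<open>
  An antichain of minimal vectors stays minimal in the smaller up-set that it generates; hence
  deleting generators of a monomial ideal leaves the remaining ones minimal.
\<close>

lemma minimal_exps_up_closure:
  assumes "A \<subseteq> minimal_exps U" shows "minimal_exps (up_closure A) = A"
proof
  show "A \<subseteq> minimal_exps (up_closure A)"
  proof
    fix a assume a: "a \<in> A"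
    have "b = a" if b: "b \<in> up_closure A" "exp_le b a" for b
    proof -
      obtain c where c: "c \<in> A" "exp_le c b" using b unfolding up_closure_def by blast
      then have "c = a" using a assms b exp_le_trans[OF c(2) b(2)] unfolding minimal_exps_def by blast
      then show ?thesis using c b exp_le_antisym by blast
    qed
    then show "a \<in> minimal_exps (up_closure A)"
      using a up_closure_superset unfolding minimal_exps_def by blast
  qed
qed (rule minimal_exps_subset_generators)

definition is_exp_lub :: "('n \<Rightarrow>\<^sub>0 nat) set \<Rightarrow> ('n \<Rightarrow>\<^sub>0 nat) \<Rightarrow> bool" where
  "is_exp_lub A w \<longleftrightarrow> (\<forall>b\<in>A. exp_le b w) \<and> (\<forall>v. (\<forall>b\<in>A. exp_le b v) \<longrightarrow> exp_le w v)"

lemma is_exp_lub_upper: "is_exp_lub A w \<Longrightarrow> b \<in> A \<Longrightarrow> exp_le b w"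
  unfolding is_exp_lub_def by blast

lemma is_exp_lub_least:
  assumes "is_exp_lub A w" and "\<And>b. b \<in> A \<Longrightarrow> exp_le b v"
  shows "exp_le w v"
  using assms unfolding is_exp_lub_def by blast

text \<open>
  The upper bound \<open>h\<close> makes the coordinatewise suprema those of bounded sets of natural numbers;
  without it \<^const>\<open>Sup\<close> would be unspecified.
\<close>

lemma is_exp_lub_exists:
  assumes "a \<in> A" and "\<And>b. b \<in> A \<Longrightarrow> exp_le b h"
  shows "\<exists>w. is_exp_lub A w"
proof -
  let ?w = "Abs_poly_mapping (\<lambda>i. Sup ((\<lambda>b. lookup b i) ` A)) :: 'a \<Rightarrow>\<^sub>0 nat"
  have le: "Sup ((\<lambda>b. lookup b i) ` A) \<le> lookup v i" if "\<And>b. b \<in> A \<Longrightarrow> exp_le b v" for v i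
    using assms(1) that by (intro cSup_least) (auto simp: exp_le_def)
  have "{i. Sup ((\<lambda>b. lookup b i) ` A) \<noteq> 0} \<subseteq> {i. lookup h i \<noteq> 0}"
    using le[of h] assms(2) by (metis (mono_tags, lifting) Collect_mono_iff le_zero_eq)
  then have "finite {i. Sup ((\<lambda>b. lookup b i) ` A) \<noteq> 0}"
    by (rule finite_subset) simp
  then have w: "lookup ?w i = Sup ((\<lambda>b. lookup b i) ` A)" for i by simp
  have "exp_le ?w v" if "\<And>b. b \<in> A \<Longrightarrow> exp_le b v" for v
    unfolding exp_le_def w using le that by blast
  moreover have "exp_le b ?w" if "b \<in> A" for b
    unfolding exp_le_def w
    using that assms(2) by (auto simp: exp_le_def intro!: cSup_upper bdd_aboveI2)
  ultimately show ?thesis unfolding is_exp_lub_def by (intro exI[of _ ?w]) blast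
qed

section \<open>Minimal exponents of the symbolic powers\<close>

text \<open>
  The condition at \<open>i\<close> says that the degree in the variables other than \<open>x\<^sub>i\<close> is at least \<open>s\<close>,
  that is, membership of the monomial in the \<open>s\<close>-th power of \<open>\<langle>x\<^sub>j : j \<noteq> i\<rangle>\<close>.
\<close>

definition symbolic_exps :: "nat \<Rightarrow> ('n::finite \<Rightarrow>\<^sub>0 nat) set" where
  "symbolic_exps s = {a. \<forall>i. s + lookup a i \<le> total_degree a}"

lemma degree_gap_mono:
  assumes "s + lookup a i \<le> total_degree a" "exp_le a b"
  shows "s + lookup b i \<le> total_degree b"
proof -
  have "total_degree b = total_degree a + total_degree (b - a)"
    using exp_le_add_diff[OF assms(2)] by (metis total_degree_add)
  moreover have "lookup (b - a) i \<le> total_degree (b - a)" by (simp add: total_degree_split[of _ i])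
  ultimately show ?thesis using assms(1) by (simp add: lookup_minus)
qed

lemma symbolic_exps_up_closed: "a \<in> symbolic_exps s \<Longrightarrow> exp_le a b \<Longrightarrow> b \<in> symbolic_exps s"
  unfolding symbolic_exps_def using degree_gap_mono by blast

lemma exists_lookup_pos: "1 \<le> total_degree a \<Longrightarrow> \<exists>i. 1 \<le> lookup a i"
  by (auto simp: total_degree_def Suc_le_eq sum_eq_0_iff simp flip: neq0_conv)

text \<open>
  If no coordinate other than \<open>c\<close> is tight and \<open>a\<^sub>c\<close> is positive, then lowering \<open>a\<^sub>c\<close> by one
  respects all inequalities; so a minimal vector has a tight coordinate besides any prescribed
  positive one, and therefore two.  Conversely, passing to a smaller admissible vector of total
  degree less by \<open>e\<close> lowers each tight coordinate by at least \<open>e\<close>, and two such drops exceed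
  the total \<open>e\<close> unless \<open>e = 0\<close>.
\<close>

lemma minimal_symbolic_exps_iff:
  assumes "1 \<le> s"
  shows "a \<in> minimal_exps (symbolic_exps s) \<longleftrightarrow> a \<in> symbolic_exps s \<and>
    (\<exists>i j. i \<noteq> j \<and> s + lookup a i = total_degree a \<and> s + lookup a j = total_degree a)"
proof
  assume a: "a \<in> minimal_exps (symbolic_exps s)"
  then have aU: "a \<in> symbolic_exps s" by (rule minimal_exps_in)
  then have ge: "s + lookup a i \<le> total_degree a" for i
    unfolding symbolic_exps_def by blast
  have no: "\<exists>j. j \<noteq> c \<and> s + lookup a j = total_degree a" if c: "1 \<le> lookup a c" for c
  proof (rule ccontr)
    assume not: "\<not> ?thesis"
    have "s + lookup (a - unit_exp c) i \<le> total_degree (a - unit_exp c)" for i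
    proof (cases "i = c")
      case True
      then show ?thesis unfolding total_degree_diff_unit[OF c]
        using ge[of c] c by (simp add: lookup_minus lookup_unit_exp)
    next
      case False
      then have "s + lookup a i \<noteq> total_degree a" using not by blast
      then show ?thesis unfolding total_degree_diff_unit[OF c]
        using ge[of i] False by (simp add: lookup_minus lookup_unit_exp)
    qed
    then have "a - unit_exp c \<in> symbolic_exps s" unfolding symbolic_exps_def by simp
    then have "a - unit_exp c = a" using minimal_exps_eq[OF a _ exp_le_diff] by blast
    then have "lookup (a - unit_exp c) c = lookup a c" by simp
    then show False using c by (simp add: lookup_minus lookup_unit_exp)
  qed
  obtain c where c: "1 \<le> lookup a c" using exists_lookup_pos ge assms by (metis le_add1 le_trans)
  then obtain i where i: "s + lookup a i = total_degree a" using no by blast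
  have "1 \<le> lookup a i" using i c ge[of c] by linarith
  then obtain j where "j \<noteq> i" "s + lookup a j = total_degree a" using no by blast
  then show "a \<in> symbolic_exps s \<and>
    (\<exists>i j. i \<noteq> j \<and> s + lookup a i = total_degree a \<and> s + lookup a j = total_degree a)"
    using i aU by blast
next
  assume "a \<in> symbolic_exps s \<and>
    (\<exists>i j. i \<noteq> j \<and> s + lookup a i = total_degree a \<and> s + lookup a j = total_degree a)"
  then obtain i j where a: "a \<in> symbolic_exps s" and ij: "i \<noteq> j"
    "s + lookup a i = total_degree a" "s + lookup a j = total_degree a" by blast
  have "b = a" if b: "b \<in> symbolic_exps s" "exp_le b a" for b
  proof (rule ccontr)
    assume "b \<noteq> a"
    then have less: "total_degree b < total_degree a" using exp_le_total_degree_less b by blast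
    have "total_degree a = total_degree b + total_degree (a - b)"
      using exp_le_add_diff[OF b(2)] by (metis total_degree_add)
    moreover have "lookup (a - b) i + lookup (a - b) j \<le> total_degree (a - b)"
      using lookup2_le_total_degree[OF ij(1)] .
    moreover have "s + lookup b i \<le> total_degree b" "s + lookup b j \<le> total_degree b"
      using b(1) unfolding symbolic_exps_def by auto
    ultimately show False using ij less by (simp add: lookup_minus)
  qed
  with a show "a \<in> minimal_exps (symbolic_exps s)" by (rule minimal_expsI)
qed

text \<open>
  A tight coordinate has the largest entry \<open>|a| - s\<close>.  Two of them together are at most \<open>|a|\<close>,
  which bounds that entry by \<open>s\<close>.
\<close>

lemma minimal_symbolic_exps_bounded:
  assumes "1 \<le> s" "a \<in> minimal_exps (symbolic_exps s)"
  shows "lookup a l \<le> s"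
proof -
  obtain i j where ij: "i \<noteq> j" "s + lookup a i = total_degree a" "s + lookup a j = total_degree a"
    and "s + lookup a l \<le> total_degree a"
    using assms minimal_symbolic_exps_iff[OF assms(1)] unfolding symbolic_exps_def by blast
  then show ?thesis using lookup2_le_total_degree[OF ij(1), of a] by linarith
qed

text \<open>
  Only the coordinate \<open>z\<close> could make a vector minimal on the left and not on the right: it
  would have to lie above an admissible \<open>b\<close> with \<open>b\<^sub>z = 0\<close>.  But then moving one unit of \<open>b\<close>
  from some other coordinate to \<open>z\<close> yields an admissible vector that involves \<open>z\<close> and lies
  strictly below the given one.
\<close>

lemma minimal_symbolic_exps_divisible:
  assumes "1 \<le> s"
  shows "minimal_exps (symbolic_exps s \<inter> {a. 1 \<le> lookup a z})
       = minimal_exps (symbolic_exps s) \<inter> {a. 1 \<le> lookup a z}"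
proof (intro equalityI subsetI)
  fix a assume a: "a \<in> minimal_exps (symbolic_exps s \<inter> {a. 1 \<le> lookup a z})"
  then have aU: "a \<in> symbolic_exps s" and az: "1 \<le> lookup a z"
    using minimal_exps_in by blast+
  have min: "b = a" if "b \<in> symbolic_exps s" "1 \<le> lookup b z" "exp_le b a" for b
    using minimal_exps_eq[OF a] that by blast
  have "b = a" if b: "b \<in> symbolic_exps s" "exp_le b a" for b
  proof (rule ccontr)
    assume "b \<noteq> a"
    then have "\<not> 1 \<le> lookup b z" using min b by blast
    then have bz: "lookup b z = 0" by simp
    have bge: "s + lookup b i \<le> total_degree b" for i using b(1) unfolding symbolic_exps_def by blast
    have "1 \<le> total_degree b" using bge[of z] assms by linarith
    then obtain j where j: "1 \<le> lookup b j" using exists_lookup_pos by blast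
    then have jz: "j \<noteq> z" using bz by auto
    let ?c = "b - unit_exp j + unit_exp z"
    have look: "lookup ?c t = (if t = z then 1 else if t = j then lookup b j - 1 else lookup b t)" for t
      using bz jz by (simp add: lookup_add lookup_minus lookup_unit_exp)
    have ble: "lookup b t \<le> lookup a t" for t using b(2) unfolding exp_le_def by blast
    have ca: "exp_le ?c a"
      unfolding exp_le_def look using az ble by (auto intro: le_trans[OF diff_le_self])
    have deg: "total_degree ?c = total_degree b"
      using \<open>1 \<le> total_degree b\<close> by (simp add: total_degree_diff_unit[OF j])
    have "s + lookup ?c i \<le> total_degree ?c" for i
      unfolding deg look using bge[of i] bge[of j] j by auto
    then have "?c \<in> symbolic_exps s" unfolding symbolic_exps_def by simp
    moreover have "1 \<le> lookup ?c z" unfolding look by simp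
    ultimately have "?c = a" using min ca by blast
    then have "lookup ?c j = lookup a j" by simp
    then show False using j jz ble[of j] unfolding look by simp
  qed
  then have "a \<in> minimal_exps (symbolic_exps s)" using aU by (intro minimal_expsI)
  then show "a \<in> minimal_exps (symbolic_exps s) \<inter> {a. 1 \<le> lookup a z}"
    using az by blast
next
  fix a assume a: "a \<in> minimal_exps (symbolic_exps s) \<inter> {a. 1 \<le> lookup a z}"
  then show "a \<in> minimal_exps (symbolic_exps s \<inter> {a. 1 \<le> lookup a z})"
    using minimal_exps_in minimal_exps_eq by (intro minimal_expsI) blast+
qed

text \<open>
  Moving a unit from \<open>c\<close> to \<open>z\<close> preserves the total degree, and it keeps two tight coordinates
  unless \<open>c\<close> is one of exactly two.  In that case both tight coordinates are lowered: the largest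
  entry and the total degree each fall by one, so the two coordinates remain tight.  For this,
  the new entry \<open>1\<close> at \<open>z\<close> must not exceed the new largest entry, which is where \<open>s \<ge> 2\<close> enters.
\<close>

lemma minimal_symbolic_exps_exchange:
  assumes s: "2 \<le> s" and u: "u \<in> minimal_exps (symbolic_exps s)"
    and uz: "lookup u z = 0" and uc: "1 \<le> lookup u c"
  shows "\<exists>v\<in>minimal_exps (symbolic_exps s). lookup v z = 1 \<and> lookup v c = lookup u c - 1 \<and>
    (\<forall>i. i \<noteq> z \<longrightarrow> lookup v i \<le> lookup u i)"
proof -
  have cz: "c \<noteq> z" using uz uc by auto
  have s1: "1 \<le> s" using s by simp
  note iff = minimal_symbolic_exps_iff[OF s1]
  have ge: "s + lookup u i \<le> total_degree u" for i using u iff unfolding symbolic_exps_def by blast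
  obtain i j where ij: "i \<noteq> j" "s + lookup u i = total_degree u" "s + lookup u j = total_degree u"
    using u iff by blast
  have tz: "t \<noteq> z" if "s + lookup u t = total_degree u" for t using that uz uc ge[of c] by auto
  show ?thesis
  proof (cases "\<exists>i j. i \<noteq> j \<and> i \<noteq> c \<and> j \<noteq> c \<and> s + lookup u i = total_degree u \<and> s + lookup u j = total_degree u")
    case True
    then obtain i j where ij: "i \<noteq> j" "i \<noteq> c" "j \<noteq> c"
      "s + lookup u i = total_degree u" "s + lookup u j = total_degree u" by blast
    let ?v = "u - unit_exp c + unit_exp z"
    have look: "lookup ?v t = (if t = z then 1 else if t = c then lookup u c - 1 else lookup u t)" for t
      using uz cz by (simp add: lookup_add lookup_minus lookup_unit_exp)
    have pos: "1 \<le> total_degree u" using ge[of c] uc by linarith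
    have deg: "total_degree ?v = total_degree u"
      using total_degree_diff_unit[OF uc] pos by simp
    have "s + lookup ?v t \<le> total_degree ?v" for t
      unfolding deg look using ge[of t] ge[of c] uc by auto
    moreover have "s + lookup ?v i = total_degree ?v" "s + lookup ?v j = total_degree ?v"
      unfolding deg look using ij tz by auto
    ultimately have "?v \<in> minimal_exps (symbolic_exps s)"
      using iff[of ?v] ij(1) unfolding symbolic_exps_def by blast
    then show ?thesis using look cz by (intro bexI[of _ ?v]) auto
  next
    case False
    obtain d where d: "d \<noteq> c" "s + lookup u d = total_degree u" using ij by metis
    have c: "s + lookup u c = total_degree u" using ij False by metis
    have other: "s + lookup u t < total_degree u" if "t \<noteq> c" "t \<noteq> d" for t
      using False d that ge[of t] by (metis order_le_neq_trans)
    have ud: "lookup u d = lookup u c" using d c by linarith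
    \<comment> \<open>If the largest entry were 1, then all positive coordinates would be tight, so only c and d, and s would be 1.\<close>
    have M: "2 \<le> lookup u c"
    proof (rule ccontr)
      assume "\<not> ?thesis"
      then have one: "lookup u c = 1" using uc by linarith
      have "lookup u t = 0" if "t \<noteq> c" "t \<noteq> d" for t using other[OF that] one c by linarith
      then have "total_degree u = (\<Sum>t\<in>{c, d}. lookup u t)"
        unfolding total_degree_def by (intro sum.mono_neutral_right) auto
      then show False using d(1) one ud c s by simp
    qed
    let ?v = "u - unit_exp c - unit_exp d + unit_exp z"
    have dz: "d \<noteq> z" using tz d by blast
    have look: "lookup ?v t = (if t = z then 1 else if t = c \<or> t = d then lookup u c - 1 else lookup u t)" for t
      using uz cz dz d(1) ud by (simp add: lookup_add lookup_minus lookup_unit_exp)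
    have "1 \<le> lookup (u - unit_exp c) d" using d(1) ud uc by (simp add: lookup_minus lookup_unit_exp)
    from total_degree_diff_unit[OF this]
    have deg: "total_degree ?v = total_degree u - 1"
      using total_degree_diff_unit[OF uc] c s by simp
    have "s + lookup ?v t \<le> total_degree ?v" for t
      unfolding deg look using other[of t] M c by auto
    moreover have "s + lookup ?v c = total_degree ?v" "s + lookup ?v d = total_degree ?v"
      unfolding deg look using c uc cz dz by auto
    ultimately have "?v \<in> minimal_exps (symbolic_exps s)"
      using iff[of ?v] d(1) unfolding symbolic_exps_def by blast
    then show ?thesis using look cz ud by (intro bexI[of _ ?v]) auto
  qed
qed

section \<open>Monomial ideals as spans of up-closed exponent sets\<close>

abbreviation keys :: "('a \<Rightarrow>\<^sub>0 'b::zero) \<Rightarrow> 'a set" where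
  "keys \<equiv> Poly_Mapping.keys"

abbreviation mon :: "('n::finite \<Rightarrow>\<^sub>0 nat) \<Rightarrow> ('n, 'k::field) mpoly" where
  "mon a \<equiv> Poly_Mapping.single a 1"

lemma mpoly_ring_simps [simp]:
  "carrier mpoly_ring = UNIV" "a \<otimes>\<^bsub>mpoly_ring\<^esub> b = a * b" "a \<oplus>\<^bsub>mpoly_ring\<^esub> b = a + b"
  "\<zero>\<^bsub>mpoly_ring\<^esub> = 0" "\<one>\<^bsub>mpoly_ring\<^esub> = 1"
  by (simp_all add: ring_of_type_algebra_def)

lemma cring_mpoly_ring: "cring (mpoly_ring :: ('n::finite, 'k::field) mpoly ring)"
  by (rule cring_from_type_algebra)

lemma ring_mpoly_ring: "ring (mpoly_ring :: ('n::finite, 'k::field) mpoly ring)"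
  by (rule ring_from_type_algebra)

lemma ideal_mpoly_ringI:
  fixes I :: "('n::finite, 'k::field) mpoly set"
  assumes I0: "0 \<in> I" and Iadd: "\<And>p q. p \<in> I \<Longrightarrow> q \<in> I \<Longrightarrow> p + q \<in> I"
    and Imult: "\<And>p q. q \<in> I \<Longrightarrow> p * q \<in> I"
  shows "ideal I mpoly_ring"
proof (rule idealI[OF ring_mpoly_ring])
  interpret cring "mpoly_ring :: ('n, 'k) mpoly ring" by (rule cring_mpoly_ring)
  have inv: "\<ominus>\<^bsub>mpoly_ring\<^esub> p = - p" for p :: "('n, 'k) mpoly"
    using add.inv_equality[of "- p" p] by simp
  show "subgroup I (add_monoid mpoly_ring)"
    using I0 Iadd Imult[of _ "- 1"] by (intro add.subgroupI) (auto simp: inv)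
qed (use Imult in \<open>auto simp: mult.commute\<close>)

lemma ideal_mpoly_ringD:
  fixes I :: "('n::finite, 'k::field) mpoly set"
  assumes "ideal I mpoly_ring"
  shows "0 \<in> I" and "p \<in> I \<Longrightarrow> q \<in> I \<Longrightarrow> p + q \<in> I" and "q \<in> I \<Longrightarrow> p * q \<in> I"
  using additive_subgroup.zero_closed[OF ideal.axioms(1)[OF assms]]
    additive_subgroup.a_closed[OF ideal.axioms(1)[OF assms], of p q]
    ideal.I_l_closed[OF assms, of q p]
  by simp_all

lemma sum_of_terms: "(\<Sum>a\<in>keys p. Poly_Mapping.single a (lookup p a)) = p"
proof (rule poly_mapping_eqI)
  fix b
  have "lookup (\<Sum>a\<in>keys p. Poly_Mapping.single a (lookup p a)) b
      = (\<Sum>a\<in>keys p. if a = b then lookup p b else 0)"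
    by (simp add: lookup_sum lookup_single when_def if_distrib cong: if_cong)
  also have "\<dots> = lookup p b" by (auto simp: in_keys_iff)
  finally show "lookup (\<Sum>a\<in>keys p. Poly_Mapping.single a (lookup p a)) b = lookup p b" .
qed

lemma mpoly_term_induct [case_names zero add]:
  fixes p :: "('n::finite, 'k::field) mpoly"
  assumes "P 0" and "\<And>p a c. P p \<Longrightarrow> P (Poly_Mapping.single a c + p)"
  shows "P p"
proof -
  have "P (\<Sum>a\<in>A. Poly_Mapping.single a (lookup p a))" if "finite A" for A
    using that by (induction A rule: finite_induct) (auto intro: assms)
  from this[OF finite_keys[of p]] show ?thesis by (simp add: sum_of_terms)
qed

lemma mon_dvd_mon_iff:
  "(mon a :: ('n::finite, 'k::field) mpoly) dvd mon b \<longleftrightarrow> exp_le a b"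
proof
  assume "(mon a :: ('n, 'k) mpoly) dvd mon b"
  then obtain q :: "('n, 'k) mpoly" where "mon b = mon a * q" by (elim dvdE)
  then have "b \<in> keys (mon a * q)" by (metis insertI1 keys_single zero_neq_one)
  then show "exp_le a b" using keys_mult[of "mon a" q] by (auto simp: exp_le_add)
next
  assume "exp_le a b"
  then have "(mon b :: ('n, 'k) mpoly) = mon a * mon (b - a)"
    by (simp add: mult_single exp_le_add_diff)
  then show "(mon a :: ('n, 'k) mpoly) dvd mon b" by simp
qed

lemma inj_mon: "inj (mon :: ('n::finite \<Rightarrow>\<^sub>0 nat) \<Rightarrow> ('n, 'k::field) mpoly)"
proof (rule injI)
  fix a b :: "'n \<Rightarrow>\<^sub>0 nat" assume "(mon a :: ('n, 'k) mpoly) = mon b"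
  from arg_cong[OF this, of keys] show "a = b" by simp
qed

lemma mon_eq_iff [simp]: "(mon a :: ('n::finite, 'k::field) mpoly) = mon b \<longleftrightarrow> a = b"
  using injD[OF inj_mon] by auto

lemma mvar_eq_mon: "mvar i = mon (unit_exp i)"
  by (simp add: mvar_def unit_exp_def)

text \<open>
  For an up-closed \<open>U\<close> this is the monomial ideal whose monomials have their exponents in \<open>U\<close>.
  Sums, intersections and products of such ideals then become unions, intersections and sumsets
  of exponent sets.
\<close>

definition spanned_by :: "('n \<Rightarrow>\<^sub>0 nat) set \<Rightarrow> ('n::finite, 'k::field) mpoly set" where
  "spanned_by U = {p. keys p \<subseteq> U}"

lemma mon_in_spanned_by_iff [simp]: "mon a \<in> spanned_by U \<longleftrightarrow> a \<in> U"
  by (simp add: spanned_by_def)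

lemma spanned_by_subset_iff:
  "(spanned_by U :: ('n::finite, 'k::field) mpoly set) \<subseteq> spanned_by V \<longleftrightarrow> U \<subseteq> V"
proof
  assume sub: "(spanned_by U :: ('n, 'k) mpoly set) \<subseteq> spanned_by V"
  show "U \<subseteq> V"
  proof
    fix a assume "a \<in> U"
    then have "(mon a :: ('n, 'k) mpoly) \<in> spanned_by U" by simp
    then have "(mon a :: ('n, 'k) mpoly) \<in> spanned_by V" using sub by blast
    then show "a \<in> V" by simp
  qed
qed (auto simp: spanned_by_def)

lemma spanned_by_inject:
  "(spanned_by U :: ('n::finite, 'k::field) mpoly set) = spanned_by V \<longleftrightarrow> U = V"
  unfolding set_eq_subset spanned_by_subset_iff by (rule refl)

lemma spanned_by_Int: "spanned_by U \<inter> spanned_by V = spanned_by (U \<inter> V)"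
  by (auto simp: spanned_by_def)

lemma ideal_spanned_by:
  assumes up: "\<And>a b. a \<in> U \<Longrightarrow> exp_le a b \<Longrightarrow> b \<in> U"
  shows "ideal (spanned_by U :: ('n::finite, 'k::field) mpoly set) mpoly_ring"
proof (rule ideal_mpoly_ringI)
  fix p q :: "('n, 'k) mpoly"
  show "p \<in> spanned_by U \<Longrightarrow> q \<in> spanned_by U \<Longrightarrow> p + q \<in> spanned_by U"
    using keys_add[of p q] by (auto simp: spanned_by_def)
  assume "q \<in> spanned_by U"
  then have "a + b \<in> U" if "b \<in> keys q" for a b
    using that up exp_le_add(2) unfolding spanned_by_def by blast
  then show "p * q \<in> spanned_by U" using keys_mult[of p q] unfolding spanned_by_def by blast
qed (simp add: spanned_by_def)

lemma spanned_by_subset_ideal: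
  fixes I :: "('n::finite, 'k::field) mpoly set"
  assumes I: "ideal I mpoly_ring" and "\<And>a. a \<in> U \<Longrightarrow> mon a \<in> I"
  shows "spanned_by U \<subseteq> I"
proof
  fix p :: "('n, 'k) mpoly" assume p: "p \<in> spanned_by U"
  have "(\<Sum>a\<in>A. Poly_Mapping.single a (lookup p a)) \<in> I" if "finite A" "A \<subseteq> keys p" for A
    using that
  proof (induction A rule: finite_induct)
    case (insert a A)
    have "mon a \<in> I" using insert.prems p assms(2) unfolding spanned_by_def by blast
    then have "Poly_Mapping.single 0 (lookup p a) * mon a \<in> I" by (rule ideal_mpoly_ringD(3)[OF I])
    then show ?case using insert ideal_mpoly_ringD(2)[OF I] by (simp add: mult_single)
  qed (simp add: ideal_mpoly_ringD(1)[OF I])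
  from this[OF finite_keys order_refl] show "p \<in> I" by (simp add: sum_of_terms)
qed

lemma Idl_monomials:
  "Idl\<^bsub>mpoly_ring\<^esub> (mon ` A) = (spanned_by (up_closure A) :: ('n::finite, 'k::field) mpoly set)"
proof
  interpret ring "mpoly_ring :: ('n, 'k) mpoly ring" by (rule ring_mpoly_ring)
  show "Idl\<^bsub>mpoly_ring\<^esub> (mon ` A) \<subseteq> (spanned_by (up_closure A) :: ('n, 'k) mpoly set)"
  proof (rule genideal_minimal)
    show "ideal (spanned_by (up_closure A)) (mpoly_ring :: ('n, 'k) mpoly ring)"
      using up_closure_up_closed by (rule ideal_spanned_by)
    show "mon ` A \<subseteq> (spanned_by (up_closure A) :: ('n, 'k) mpoly set)"
      using up_closure_superset[of A] by auto
  qed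
  have I: "ideal (Idl\<^bsub>mpoly_ring\<^esub> (mon ` A)) (mpoly_ring :: ('n, 'k) mpoly ring)"
    by (rule genideal_ideal) simp
  show "(spanned_by (up_closure A) :: ('n, 'k) mpoly set) \<subseteq> Idl\<^bsub>mpoly_ring\<^esub> (mon ` A)"
  proof (rule spanned_by_subset_ideal[OF I])
    fix b assume "b \<in> up_closure A"
    then obtain a where a: "a \<in> A" "exp_le a b" unfolding up_closure_def by blast
    have "mon a \<in> Idl\<^bsub>mpoly_ring\<^esub> (mon ` A :: ('n, 'k) mpoly set)" using genideal_self[of "mon ` A"] a(1) by auto
    then have "mon (b - a) * mon a \<in> Idl\<^bsub>mpoly_ring\<^esub> (mon ` A :: ('n, 'k) mpoly set)"
      by (rule ideal_mpoly_ringD(3)[OF I])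
    then show "mon b \<in> Idl\<^bsub>mpoly_ring\<^esub> (mon ` A :: ('n, 'k) mpoly set)"
      using exp_le_add_diff[OF a(2)] by (simp add: mult_single add.commute)
  qed
qed

lemma monomial_ideal_spanned_by:
  assumes "\<And>a b. a \<in> U \<Longrightarrow> exp_le a b \<Longrightarrow> b \<in> U"
  shows "monomial_ideal (spanned_by U :: ('n::finite, 'k::field) mpoly set)"
proof -
  have "up_closure U = U" by (rule up_closure_of_up_closed) (rule assms)
  then have "spanned_by U = Idl\<^bsub>mpoly_ring\<^esub> (mon ` U :: ('n, 'k) mpoly set)" by (simp add: Idl_monomials)
  moreover have "mon ` U \<subseteq> (monomials :: ('n, 'k) mpoly set)" by (auto simp: monomials_def)
  ultimately show ?thesis unfolding monomial_ideal_def by metis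
qed

text \<open>
  A set of monomials generates the ideal iff its exponents have \<open>U\<close> as up-closure, and every
  such set contains the minimal vectors of \<open>U\<close>, which themselves suffice.
\<close>

lemma min_gens_spanned_by:
  assumes up: "\<And>a b. a \<in> U \<Longrightarrow> exp_le a b \<Longrightarrow> b \<in> U"
  shows "min_gens (spanned_by U :: ('n::finite, 'k::field) mpoly set) = mon ` minimal_exps U"
proof -
  have gen: "Idl\<^bsub>mpoly_ring\<^esub> (mon ` A) = (spanned_by U :: ('n, 'k) mpoly set) \<longleftrightarrow> up_closure A = U" for A
    by (simp add: Idl_monomials spanned_by_inject)
  have least: "minimal_exps U \<subseteq> A" if "up_closure A = U" for A
    using minimal_exps_subset_generators[of A] that by simp
  show ?thesis
    unfolding min_gens_def
  proof (rule the_equality, intro conjI allI impI)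
    show "mon ` minimal_exps U \<subseteq> (monomials :: ('n, 'k) mpoly set)" by (auto simp: monomials_def)
    show "Idl\<^bsub>mpoly_ring\<^esub> (mon ` minimal_exps U) = (spanned_by U :: ('n, 'k) mpoly set)"
      unfolding gen by (rule up_closure_minimal_exps) (rule up)
    fix B :: "('n, 'k) mpoly set" assume B: "B \<subset> mon ` minimal_exps U"
    then obtain A where A: "B = mon ` A" "A \<subseteq> minimal_exps U"
      by (meson psubset_imp_subset subset_imageE)
    then show "Idl\<^bsub>mpoly_ring\<^esub> B \<noteq> spanned_by U" using least[of A] B gen[of A] by blast
  next
    fix B :: "('n, 'k) mpoly set"
    assume B: "B \<subseteq> monomials \<and> Idl\<^bsub>mpoly_ring\<^esub> B = spanned_by U \<and>
      (\<forall>C. C \<subset> B \<longrightarrow> Idl\<^bsub>mpoly_ring\<^esub> C \<noteq> spanned_by U)"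
    then obtain A where A: "B = mon ` A" unfolding monomials_def by (meson subset_imageE)
    have "up_closure A = U" using B gen[of A] unfolding A by (elim conjE) (rule iffD1)
    then have "mon ` minimal_exps U \<subseteq> B" unfolding A by (intro image_mono least)
    moreover have "Idl\<^bsub>mpoly_ring\<^esub> (mon ` minimal_exps U) = (spanned_by U :: ('n, 'k) mpoly set)"
      unfolding gen by (rule up_closure_minimal_exps) (rule up)
    ultimately show "B = mon ` minimal_exps U" using B unfolding psubset_eq by metis
  qed
qed

lemma spanned_by_Un:
  assumes U: "\<And>a b. a \<in> U \<Longrightarrow> exp_le a b \<Longrightarrow> b \<in> U" and V: "\<And>a b. a \<in> V \<Longrightarrow> exp_le a b \<Longrightarrow> b \<in> V"
  shows "spanned_by (U \<union> V) = (spanned_by U <+>\<^bsub>mpoly_ring\<^esub> spanned_by V :: ('n::finite, 'k::field) mpoly set)"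
proof
  interpret ring "mpoly_ring :: ('n, 'k) mpoly ring" by (rule ring_mpoly_ring)
  have IU: "ideal (spanned_by U :: ('n, 'k) mpoly set) mpoly_ring" by (rule ideal_spanned_by) (rule U)
  have IV: "ideal (spanned_by V :: ('n, 'k) mpoly set) mpoly_ring" by (rule ideal_spanned_by) (rule V)
  have IUV: "ideal (spanned_by (U \<union> V) :: ('n, 'k) mpoly set) mpoly_ring"
    using U V by (intro ideal_spanned_by) blast
  show "spanned_by (U \<union> V) \<subseteq> (spanned_by U <+>\<^bsub>mpoly_ring\<^esub> spanned_by V :: ('n, 'k) mpoly set)"
  proof (rule spanned_by_subset_ideal[OF add_ideals[OF IU IV]])
    fix a assume "a \<in> U \<union> V"
    then have "\<exists>p\<in>spanned_by U. \<exists>q\<in>spanned_by V. mon a = p + (q :: ('n, 'k) mpoly)"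
    proof
      assume "a \<in> U"
      then show ?thesis
        using ideal_mpoly_ringD(1)[OF IV] by (intro bexI[of _ "mon a"] bexI[of _ 0]) simp_all
    next
      assume "a \<in> V"
      then show ?thesis
        using ideal_mpoly_ringD(1)[OF IU] by (intro bexI[of _ 0] bexI[of _ "mon a"]) simp_all
    qed
    then show "mon a \<in> (spanned_by U <+>\<^bsub>mpoly_ring\<^esub> spanned_by V :: ('n, 'k) mpoly set)"
      by (auto simp: set_add_def')
  qed
  have "(spanned_by U :: ('n, 'k) mpoly set) \<subseteq> spanned_by (U \<union> V)"
    "(spanned_by V :: ('n, 'k) mpoly set) \<subseteq> spanned_by (U \<union> V)"
    by (simp_all add: spanned_by_subset_iff)
  then show "(spanned_by U <+>\<^bsub>mpoly_ring\<^esub> spanned_by V :: ('n, 'k) mpoly set) \<subseteq> spanned_by (U \<union> V)"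
    using ideal_mpoly_ringD(2)[OF IUV] by (auto simp: set_add_def' subset_iff)
qed

lemma ideal_prod_spanned_by:
  assumes U: "\<And>a b. a \<in> U \<Longrightarrow> exp_le a b \<Longrightarrow> b \<in> U" and V: "\<And>a b. a \<in> V \<Longrightarrow> exp_le a b \<Longrightarrow> b \<in> V"
  shows "ideal_prod mpoly_ring (spanned_by U) (spanned_by V)
       = (spanned_by {a + b | a b. a \<in> U \<and> b \<in> V} :: ('n::finite, 'k::field) mpoly set)"
    (is "?P = spanned_by ?W")
proof
  interpret ring "mpoly_ring :: ('n, 'k) mpoly ring" by (rule ring_mpoly_ring)
  have "ideal (spanned_by U :: ('n, 'k) mpoly set) mpoly_ring" by (rule ideal_spanned_by) (rule U)
  moreover have "ideal (spanned_by V :: ('n, 'k) mpoly set) mpoly_ring" by (rule ideal_spanned_by) (rule V)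
  ultimately have I: "ideal ?P mpoly_ring" by (rule ideal_prod_is_ideal)
  show "spanned_by ?W \<subseteq> ?P"
  proof (rule spanned_by_subset_ideal[OF I])
    fix c assume "c \<in> ?W"
    then obtain a b where "c = a + b" "a \<in> U" "b \<in> V" by blast
    then show "mon c \<in> ?P"
      using ideal_prod.prod[of "mon a" "spanned_by U" "mon b" "spanned_by V" "mpoly_ring :: ('n, 'k) mpoly ring"]
      by (simp add: mult_single)
  qed
  show "?P \<subseteq> spanned_by ?W"
  proof
    fix p assume "p \<in> ?P"
    then show "p \<in> spanned_by ?W"
    proof induction
      case (prod p q)
      then show ?case using keys_mult[of p q] unfolding spanned_by_def mpoly_ring_simps by blast
    next
      case (sum p q)
      then show ?case using keys_add[of p q] unfolding spanned_by_def mpoly_ring_simps by blast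
    qed
  qed
qed

section \<open>Least common multiples of monomials\<close>

lemma monomial_lcm_eq:
  assumes lub: "is_exp_lub A w"
  shows "monomial_lcm (mon ` A) = (mon w :: ('n::finite, 'k::field) mpoly)"
  unfolding monomial_lcm_def
proof (rule the_equality)
  show "mon w \<in> monomials \<and> (\<forall>u\<in>mon ` A. u dvd (mon w :: ('n, 'k) mpoly)) \<and>
    (\<forall>v\<in>monomials. (\<forall>u\<in>mon ` A. u dvd v) \<longrightarrow> mon w dvd (v :: ('n, 'k) mpoly))"
    using lub unfolding monomials_def is_exp_lub_def by (auto simp: mon_dvd_mon_iff)
next
  fix x :: "('n, 'k) mpoly"
  assume x: "x \<in> monomials \<and> (\<forall>u\<in>mon ` A. u dvd x) \<and>
    (\<forall>v\<in>monomials. (\<forall>u\<in>mon ` A. u dvd v) \<longrightarrow> x dvd v)"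
  then obtain y where y: "x = mon y" unfolding monomials_def by blast
  have "exp_le b y" if "b \<in> A" for b using x that unfolding y by (auto simp: mon_dvd_mon_iff)
  then have "exp_le w y" by (rule is_exp_lub_least[OF lub])
  moreover have "exp_le y w" using x is_exp_lub_upper[OF lub] unfolding y monomials_def by (auto simp: mon_dvd_mon_iff)
  ultimately show "x = mon w" using exp_le_antisym y by blast
qed

text \<open>
  Since \<open>f\<close> raises no coordinate and lowers \<open>c\<close> wherever it is positive, the least upper bound
  of \<open>A\<close>, itself lowered by one at \<open>c\<close>, is still an upper bound of the image.
\<close>

lemma strictly_divides_lcm:
  assumes a: "a \<in> A" "1 \<le> lookup a c" and bound: "\<And>b. b \<in> A \<Longrightarrow> exp_le b h"
    and le: "\<And>b. b \<in> A \<Longrightarrow> exp_le (f b) b"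
    and less: "\<And>b. b \<in> A \<Longrightarrow> lookup (f b) c \<le> lookup b c - 1"
  shows "strictly_divides (monomial_lcm (mon ` f ` A)) (monomial_lcm (mon ` A) :: ('n::finite, 'k::field) mpoly)"
proof -
  obtain w where lub: "is_exp_lub A w"
    using is_exp_lub_exists[OF a(1) bound] by blast
  note w = is_exp_lub_upper[OF lub]
  have fw: "exp_le b w" if "b \<in> f ` A" for b
    using that exp_le_trans[OF le w] by blast
  obtain w' where lub': "is_exp_lub (f ` A) w'"
    using is_exp_lub_exists[OF imageI[OF a(1)] fw] by blast
  have "exp_le w' (w - unit_exp c)"
  proof (rule is_exp_lub_least[OF lub'])
    fix b assume "b \<in> f ` A"
    then obtain d where d: "b = f d" "d \<in> A" by blast
    have "lookup b i \<le> lookup (w - unit_exp c) i" for i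
    proof -
      have "lookup (f d) i \<le> lookup w i" "lookup d i \<le> lookup w i"
        using fw[OF \<open>b \<in> f ` A\<close>] w[OF d(2)] unfolding exp_le_def d(1) by blast+
      then show ?thesis
        using less[OF d(2)] unfolding d(1) lookup_minus lookup_unit_exp by (cases "c = i") auto
    qed
    then show "exp_le b (w - unit_exp c)" unfolding exp_le_def by blast
  qed
  then have "lookup w' c \<le> lookup w c - 1" unfolding exp_le_def by (auto simp: lookup_minus lookup_unit_exp dest: spec[of _ c])
  moreover have "1 \<le> lookup w c" using a(2) w[OF a(1)] le_trans unfolding exp_le_def by blast
  ultimately have "w' \<noteq> w" by auto
  moreover have "exp_le w' w" by (rule is_exp_lub_least[OF lub' fw])
  moreover have "monomial_lcm (mon ` A) = (mon w :: ('n, 'k) mpoly)" by (rule monomial_lcm_eq[OF lub])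
  moreover have "monomial_lcm (mon ` f ` A) = (mon w' :: ('n, 'k) mpoly)" by (rule monomial_lcm_eq[OF lub'])
  ultimately show ?thesis by (simp add: strictly_divides_def mon_dvd_mon_iff)
qed

section \<open>The symbolic powers of the edge ideal of a complete graph\<close>

text \<open>
  The polynomial restricted to the coordinate axis \<open>i\<close>, all other variables being set to zero.
  Power series serve as target since they form an integral domain and a series is given by
  an arbitrary coefficient function.
\<close>

definition axis_part :: "'n \<Rightarrow> ('n::finite, 'k::field) mpoly \<Rightarrow> 'k fps" where
  "axis_part i p = Abs_fps (\<lambda>n. lookup p (Poly_Mapping.single i n))"

lemma axis_part_add: "axis_part i (p + q) = axis_part i p + axis_part i q"
  by (simp add: axis_part_def lookup_add fps_eq_iff)

lemma axis_part_zero: "axis_part i 0 = 0"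
  by (simp add: axis_part_def fps_eq_iff)

lemma axis_part_single:
  "axis_part i (Poly_Mapping.single a c) =
    (if a = Poly_Mapping.single i (lookup a i) then fps_const c * fps_X ^ lookup a i else 0)"
  by (auto simp: axis_part_def fps_eq_iff lookup_single when_def)

lemma axis_part_mult_single:
  "axis_part i (Poly_Mapping.single a c * Poly_Mapping.single b d)
    = axis_part i (Poly_Mapping.single a c) * axis_part i (Poly_Mapping.single b d)"
proof -
  have iff: "a + b = Poly_Mapping.single i (lookup (a + b) i) \<longleftrightarrow>
    a = Poly_Mapping.single i (lookup a i) \<and> b = Poly_Mapping.single i (lookup b i)"
    by (auto simp: poly_mapping_eq_iff fun_eq_iff lookup_add lookup_single when_def)
  have "fps_const (c * d) * fps_X ^ (m + n) = (fps_const c * fps_X ^ m) * (fps_const d * fps_X ^ n)" for m n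
    by (simp add: power_add fps_const_mult[symmetric] mult_ac del: fps_const_mult)
  then show ?thesis
    unfolding mult_single axis_part_single iff unfolding lookup_add by (simp del: fps_const_mult)
qed

text \<open>
  Both sides are additive in each factor, so it is enough to compare single terms.
\<close>

lemma axis_part_mult: "axis_part i (p * q) = axis_part i p * axis_part i q"
proof -
  have "axis_part i (Poly_Mapping.single a c * q) = axis_part i (Poly_Mapping.single a c) * axis_part i q" for a c
    by (induction q rule: mpoly_term_induct)
      (simp_all add: axis_part_zero axis_part_add distrib_left axis_part_mult_single)
  then show ?thesis
    by (induction p rule: mpoly_term_induct)
      (simp_all add: axis_part_zero axis_part_add distrib_right)
qed

text \<open>
  The exponents of the monomials in the \<open>s\<close>-th power of the prime \<open>\<langle>x\<^sub>j : j \<noteq> i\<rangle>\<close>.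
\<close>

abbreviation off_axis_exps :: "'n \<Rightarrow> nat \<Rightarrow> ('n::finite \<Rightarrow>\<^sub>0 nat) set" where
  "off_axis_exps i s \<equiv> {a. s + lookup a i \<le> total_degree a}"

lemma off_axis_up_closed: "a \<in> off_axis_exps i s \<Longrightarrow> exp_le a b \<Longrightarrow> b \<in> off_axis_exps i s"
  using degree_gap_mono by blast

text \<open>
  The prime \<open>\<langle>x\<^sub>j : j \<noteq> i\<rangle>\<close> is the kernel of a ring homomorphism into an integral domain.
\<close>

lemma off_axis_prime_eq_kernel:
  "spanned_by (off_axis_exps i 1) = {p. axis_part i p = 0}"
proof -
  have off: "a \<in> off_axis_exps i 1 \<longleftrightarrow> (\<nexists>n. a = Poly_Mapping.single i n)" for a :: "'a \<Rightarrow>\<^sub>0 nat"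
  proof -
    have "(\<exists>n. a = Poly_Mapping.single i n) \<longleftrightarrow> (\<forall>j. j \<noteq> i \<longrightarrow> lookup a j = 0)"
      by (auto simp: poly_mapping_eq_iff fun_eq_iff lookup_single when_def)
    then show ?thesis
      unfolding mem_Collect_eq Suc_lookup_le_total_degree_iff by (simp add: Suc_le_eq)
  qed
  show ?thesis
    unfolding spanned_by_def subset_iff off by (auto simp: axis_part_def fps_eq_iff in_keys_iff)
qed

lemma primeideal_off_axis:
  "primeideal (spanned_by (off_axis_exps i 1) :: ('n::finite, 'k::field) mpoly set) mpoly_ring"
proof (rule primeidealI)
  show "ideal (spanned_by (off_axis_exps i 1) :: ('n, 'k) mpoly set) mpoly_ring"
    using off_axis_up_closed by (rule ideal_spanned_by)
  show "cring (mpoly_ring :: ('n, 'k) mpoly ring)" by (rule cring_mpoly_ring)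
  have "mon (unit_exp i) \<notin> (spanned_by (off_axis_exps i 1) :: ('n, 'k) mpoly set)"
    unfolding mon_in_spanned_by_iff by (simp add: lookup_unit_exp)
  then show "carrier mpoly_ring \<noteq> (spanned_by (off_axis_exps i 1) :: ('n, 'k) mpoly set)"
    unfolding mpoly_ring_simps by (metis UNIV_I)
  fix p q :: "('n, 'k) mpoly"
  assume "p \<otimes>\<^bsub>mpoly_ring\<^esub> q \<in> spanned_by (off_axis_exps i 1)"
  then show "p \<in> spanned_by (off_axis_exps i 1) \<or> q \<in> spanned_by (off_axis_exps i 1)"
    unfolding mpoly_ring_simps off_axis_prime_eq_kernel mem_Collect_eq axis_part_mult by simp
qed

lemma off_axis_exps_Suc:
  "{a + b | a b. a \<in> off_axis_exps i s \<and> b \<in> off_axis_exps i 1} = off_axis_exps i (Suc s)"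
proof (intro equalityI subsetI)
  fix c :: "'a \<Rightarrow>\<^sub>0 nat" assume c: "c \<in> off_axis_exps i (Suc s)"
  then have "1 + lookup c i \<le> total_degree c" by simp
  then obtain j where j: "j \<noteq> i" "1 \<le> lookup c j" unfolding Suc_lookup_le_total_degree_iff by blast
  have "s + lookup (c - unit_exp j) i \<le> total_degree (c - unit_exp j)"
    unfolding total_degree_diff_unit[OF j(2)] using c j(1) by (simp add: lookup_minus lookup_unit_exp)
  moreover have "1 + lookup (unit_exp j) i \<le> total_degree (unit_exp j)"
    using j(1) by (simp add: lookup_unit_exp)
  moreover have "c = (c - unit_exp j) + unit_exp j"
    using exp_le_add_diff[of "unit_exp j" c] j(2) by (simp add: unit_exp_le_iff add.commute)
  ultimately show "c \<in> {a + b | a b. a \<in> off_axis_exps i s \<and> b \<in> off_axis_exps i 1}" by blast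
qed (auto simp: lookup_add)

lemma off_axis_prime_power:
  "spanned_by (off_axis_exps i 1) [^]\<^bsub>ideals_set mpoly_ring\<^esub> s
    = (spanned_by (off_axis_exps i s) :: ('n::finite, 'k::field) mpoly set)"
proof (induction s)
  case 0
  have "off_axis_exps i 0 = UNIV" by (simp add: total_degree_split[of _ i])
  then show ?case by (simp add: ideals_set_def nat_pow_def spanned_by_def)
next
  case (Suc s)
  have "spanned_by (off_axis_exps i 1) [^]\<^bsub>ideals_set mpoly_ring\<^esub> Suc s
    = ideal_prod mpoly_ring (spanned_by (off_axis_exps i s)) (spanned_by (off_axis_exps i 1) :: ('n, 'k) mpoly set)"
    using Suc by (simp add: ideals_set_def nat_pow_def)
  also have "\<dots> = spanned_by (off_axis_exps i (Suc s))"
    unfolding off_axis_exps_Suc[symmetric] by (rule ideal_prod_spanned_by) (fact off_axis_up_closed)+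
  finally show ?case .
qed

lemma symbolic_exps_eq: "symbolic_exps s = (\<Inter>i. off_axis_exps i s)"
  by (auto simp: symbolic_exps_def)

text \<open>
  A monomial lies in all the primes \<open>\<langle>x\<^sub>j : j \<noteq> i\<rangle>\<close> iff at least two variables divide it, that is,
  iff it is a multiple of an edge.
\<close>

lemma edge_ideal_complete_graph:
  "edge_ideal (complete_graph_edges UNIV) = (spanned_by (symbolic_exps 1) :: ('n::finite, 'k::field) mpoly set)"
proof -
  let ?E = "{unit_exp i + unit_exp j | i j. i \<noteq> (j :: 'n)}"
  have "{mvar i * mvar j | i j. {i, j} \<in> complete_graph_edges UNIV}
      = (mon ` ?E :: ('n, 'k) mpoly set)"
    unfolding complete_graph_edges_def mvar_eq_mon mult_single
    by (force simp: doubleton_eq_iff)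
  moreover have "up_closure ?E = symbolic_exps 1"
  proof (intro equalityI subsetI)
    fix b assume "b \<in> up_closure ?E"
    then obtain i j where ij: "i \<noteq> j" "exp_le (unit_exp i + unit_exp j) b"
      unfolding up_closure_def by blast
    have "unit_exp i + unit_exp j \<in> symbolic_exps 1"
      using ij(1) by (auto simp: symbolic_exps_def lookup_add lookup_unit_exp)
    then show "b \<in> symbolic_exps 1" using ij(2) symbolic_exps_up_closed by blast
  next
    fix b :: "'n \<Rightarrow>\<^sub>0 nat" assume "b \<in> symbolic_exps 1"
    then have ex: "\<exists>j. j \<noteq> i \<and> 1 \<le> lookup b j" for i
      unfolding symbolic_exps_def mem_Collect_eq Suc_lookup_le_total_degree_iff by blast
    obtain i where i: "1 \<le> lookup b i" using ex by blast
    obtain j where j: "j \<noteq> i" "1 \<le> lookup b j" using ex by blast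
    have "exp_le (unit_exp i + unit_exp j) b"
      using i j by (auto simp: exp_le_def lookup_add lookup_unit_exp)
    then show "b \<in> up_closure ?E" using j(1) unfolding up_closure_def by blast
  qed
  ultimately show ?thesis unfolding edge_ideal_def by (simp add: Idl_monomials)
qed

lemma spanned_by_INT: "spanned_by (\<Inter>i. U i) = (\<Inter>i. spanned_by (U i))"
  by (auto simp: spanned_by_def)

theorem symbolic_power_complete_graph:
  "symbolic_power mpoly_ring (edge_ideal (complete_graph_edges UNIV)) s
    = (spanned_by (symbolic_exps s) :: ('n::finite, 'k::field) mpoly set)"
proof -
  interpret cring "mpoly_ring :: ('n, 'k) mpoly ring" by (rule cring_mpoly_ring)
  let ?P = "\<lambda>i. spanned_by (off_axis_exps i 1) :: ('n, 'k) mpoly set"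
  have eq: "i = j" if "?P i \<subseteq> ?P j" for i j
  proof (rule ccontr)
    assume "i \<noteq> j"
    then have "unit_exp j \<in> off_axis_exps i 1" "unit_exp j \<notin> off_axis_exps j 1"
      by (simp_all add: lookup_unit_exp)
    then show False using that unfolding spanned_by_subset_iff by blast
  qed
  have "symbolic_power mpoly_ring (carrier mpoly_ring \<inter> \<Inter>(range ?P)) s
      = carrier mpoly_ring \<inter> (\<Inter>P\<in>range ?P. P [^]\<^bsub>ideals_set mpoly_ring\<^esub> s)"
  proof (rule symbolic_power_Inter_primes)
    show "primeideal P mpoly_ring" if "P \<in> range ?P" for P using that primeideal_off_axis by blast
    show "P = Q" if "P \<in> range ?P" "Q \<in> range ?P" "P \<subseteq> Q" for P Q using that eq by blast
  qed simp
  then show ?thesis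
    unfolding edge_ideal_complete_graph symbolic_exps_eq spanned_by_INT
    unfolding mpoly_ring_simps image_image off_axis_prime_power by simp
qed

section \<open>The splitting\<close>

lemma multiple_of_variable_ideal:
  "Idl\<^bsub>mpoly_ring\<^esub> {mvar z} = (spanned_by {a. 1 \<le> lookup a z} :: ('n::finite, 'k::field) mpoly set)"
proof -
  have "up_closure {unit_exp z} = {a. 1 \<le> lookup a z}"
    unfolding up_closure_def by (auto simp: unit_exp_le_iff)
  then show ?thesis using Idl_monomials[of "{unit_exp z}"] by (simp add: mvar_eq_mon)
qed

text \<open>
  The numbering \<open>r\<close> fixes the order of the variables in which \<open>x\<^sub>c\<close> is the first divisor of \<open>u\<close>.
\<close>

lemma first_variable_exchange:
  fixes r :: "'n::finite \<Rightarrow> nat"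
  assumes s: "2 \<le> s" and u: "u \<in> minimal_exps (symbolic_exps s)" and uz: "lookup u z = 0"
  shows "\<exists>c v. 1 \<le> lookup u c \<and> (\<forall>i. 1 \<le> lookup u i \<longrightarrow> r c \<le> r i) \<and>
    v \<in> minimal_exps (symbolic_exps s) \<and> lookup v z = 1 \<and> lookup v c = lookup u c - 1 \<and>
    (\<forall>i. i \<noteq> z \<longrightarrow> lookup v i \<le> lookup u i)"
proof -
  have "s + lookup u z \<le> total_degree u"
    using minimal_exps_in[OF u] unfolding symbolic_exps_def by blast
  then have "1 \<le> total_degree u" using s by linarith
  then obtain i where "1 \<le> lookup u i" using exists_lookup_pos by blast
  then obtain c where c: "1 \<le> lookup u c" "\<forall>i. 1 \<le> lookup u i \<longrightarrow> r c \<le> r i"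
    using ex_has_least_nat[of "\<lambda>i. 1 \<le> lookup u i" i r] by blast
  then show ?thesis using minimal_symbolic_exps_exchange[OF s u uz c(1)] by blast
qed

text \<open>
  The set \<open>A\<close> consists of the minimal generators without \<open>x\<^sub>z\<close>.  The functions \<open>f\<close> and \<open>g\<close>
  below are the two components of the splitting function on exponents, for \<open>b = u + e\<^sub>z\<close>
  with \<open>u\<close> in \<open>A\<close>.
\<close>

theorem EK_splitting_symbolic_exps:
  fixes z :: "'n::finite" and s :: nat
  defines "A \<equiv> minimal_exps (symbolic_exps s) \<inter> {a. lookup a z = 0}"
    and "K \<equiv> symbolic_exps s \<inter> {a. 1 \<le> lookup a z}"
  assumes s: "2 \<le> s"
  shows "EK_splitting (spanned_by (symbolic_exps s)) (spanned_by (up_closure A))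
    (spanned_by K :: ('n, 'k::field) mpoly set)"
proof -
  let ?U = "symbolic_exps s :: ('n \<Rightarrow>\<^sub>0 nat) set"
  let ?W = "minimal_exps (up_closure A \<inter> K)"
  have s1: "1 \<le> s" using s by simp
  have upU: "b \<in> ?U" if "a \<in> ?U" "exp_le a b" for a b using that symbolic_exps_up_closed by blast
  have upJ: "b \<in> up_closure A" if "a \<in> up_closure A" "exp_le a b" for a b
    using that up_closure_up_closed by blast
  have upK: "b \<in> K" if "a \<in> K" "exp_le a b" for a b
    using that upU unfolding K_def exp_le_def by (blast intro: le_trans)
  have upJK: "b \<in> up_closure A \<inter> K" if "a \<in> up_closure A \<inter> K" "exp_le a b" for a b
    using that upJ upK by blast
  have minJ: "minimal_exps (up_closure A) = A"
    by (rule minimal_exps_up_closure[of _ ?U]) (simp add: A_def)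
  have minK: "minimal_exps K = minimal_exps ?U \<inter> {a. 1 \<le> lookup a z}"
    unfolding K_def by (rule minimal_symbolic_exps_divisible[OF s1])
  have AU: "A \<subseteq> minimal_exps ?U" by (simp add: A_def)
  have gensI: "min_gens (spanned_by ?U) = (mon ` minimal_exps ?U :: ('n, 'k) mpoly set)"
    by (rule min_gens_spanned_by) (rule upU)
  have gensJ: "min_gens (spanned_by (up_closure A)) = (mon ` A :: ('n, 'k) mpoly set)"
    by (rule trans[OF min_gens_spanned_by]) (auto simp: minJ intro: upJ)
  have gensK: "min_gens (spanned_by K) = (mon ` (minimal_exps ?U \<inter> {a. 1 \<le> lookup a z}) :: ('n, 'k) mpoly set)"
    by (rule trans[OF min_gens_spanned_by]) (auto simp: minK intro: upK)
  have gensJK: "min_gens (spanned_by (up_closure A) \<inter> spanned_by K) = (mon ` ?W :: ('n, 'k) mpoly set)"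
    unfolding spanned_by_Int by (rule min_gens_spanned_by) (rule upJK)

  have split: "minimal_exps ?U = A \<union> (minimal_exps ?U \<inter> {a. 1 \<le> lookup a z})"
    by (auto simp: A_def Suc_le_eq)
  have "?U = up_closure A \<union> K"
  proof (intro equalityI subsetI)
    fix b assume b: "b \<in> ?U"
    obtain a where a: "a \<in> minimal_exps ?U" "exp_le a b" using minimal_exps_below[OF b] by blast
    show "b \<in> up_closure A \<union> K"
    proof (cases "lookup a z = 0")
      case True
      then show ?thesis using a unfolding A_def up_closure_def by blast
    next
      case False
      then have "a \<in> K" using minimal_exps_in[OF a(1)] by (simp add: K_def)
      then show ?thesis using upK a(2) by blast
    qed
  next
    fix b assume "b \<in> up_closure A \<union> K"
    then show "b \<in> ?U" using AU minimal_exps_in upU unfolding up_closure_def K_def by blast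
  qed
  then have sum: "spanned_by ?U = (spanned_by (up_closure A) <+>\<^bsub>mpoly_ring\<^esub> spanned_by K :: ('n, 'k) mpoly set)"
    by (rule ssubst) (rule spanned_by_Un; fact upJ upK)

  have W: "b - unit_exp z \<in> A \<and> b = (b - unit_exp z) + unit_exp z" if b: "b \<in> ?W" for b
  proof -
    have "b \<in> up_closure A" "b \<in> K" using minimal_exps_in[OF b] by auto
    then obtain u where u: "u \<in> A" "exp_le u b" and bz: "1 \<le> lookup b z"
      unfolding up_closure_def K_def by blast
    have uz: "lookup u z = 0" using u(1) by (simp add: A_def)
    have "u + unit_exp z \<in> up_closure A" using u(1) exp_le_add(1) unfolding up_closure_def by blast
    moreover have "u + unit_exp z \<in> K"
      using upU[OF minimal_exps_in exp_le_add(1)] AU u(1) unfolding K_def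
      by (auto simp: lookup_add lookup_unit_exp)
    moreover have "exp_le (u + unit_exp z) b"
      using u(2) uz bz unfolding exp_le_def by (auto simp: lookup_add lookup_unit_exp)
    ultimately have "u + unit_exp z = b" using minimal_exps_eq[OF b] by blast
    then have "b - unit_exp z = u" "b = u + unit_exp z" by auto
    then show ?thesis using u(1) by simp
  qed

  obtain r :: "'n \<Rightarrow> nat" where r: "inj r"
    using finite_imp_inj_to_nat_seg[of "UNIV :: 'n set"] by auto
  have "\<forall>u. \<exists>c v. u \<in> A \<longrightarrow> 1 \<le> lookup u c \<and> (\<forall>i. 1 \<le> lookup u i \<longrightarrow> r c \<le> r i) \<and>
    v \<in> minimal_exps ?U \<and> lookup v z = 1 \<and> lookup v c = lookup u c - 1 \<and>
    (\<forall>i. i \<noteq> z \<longrightarrow> lookup v i \<le> lookup u i)"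
    using first_variable_exchange[OF s] unfolding A_def by blast
  then obtain c v where cv: "\<forall>u. u \<in> A \<longrightarrow> 1 \<le> lookup u (c u) \<and> (\<forall>i. 1 \<le> lookup u i \<longrightarrow> r (c u) \<le> r i) \<and>
    v u \<in> minimal_exps ?U \<and> lookup (v u) z = 1 \<and> lookup (v u) (c u) = lookup u (c u) - 1 \<and>
    (\<forall>i. i \<noteq> z \<longrightarrow> lookup (v u) i \<le> lookup u i)"
    by metis
  define f where "f b = b - unit_exp z" for b :: "'n \<Rightarrow>\<^sub>0 nat"
  define g where "g b = v (f b)" for b
  \<comment> \<open>A monomial has exactly one exponent in its support, recovered here by the_elem.\<close>
  define \<phi> where "\<phi> w = (mon (f (the_elem (keys w))) :: ('n, 'k) mpoly)" for w :: "('n, 'k) mpoly"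
  define \<psi> where "\<psi> w = (mon (g (the_elem (keys w))) :: ('n, 'k) mpoly)" for w :: "('n, 'k) mpoly"
  have \<phi>: "\<phi> (mon b) = mon (f b)" and \<psi>: "\<psi> (mon b) = mon (g b)" for b by (simp_all add: \<phi>_def \<psi>_def)

  have fA: "f b \<in> A" if "b \<in> ?W" for b using W[OF that] unfolding f_def by blast
  have fz: "lookup (f b) z = 0" if "b \<in> ?W" for b using fA[OF that] unfolding A_def by blast
  have look: "lookup b i = (if i = z then 1 else lookup (f b) i)" if b: "b \<in> ?W" for b i
  proof -
    have "lookup b i = lookup (f b + unit_exp z) i" using W[OF b] unfolding f_def by metis
    then show ?thesis using fz[OF b] by (simp add: lookup_add lookup_unit_exp)
  qed
  have gK: "g b \<in> minimal_exps ?U" and gz: "lookup (g b) z = 1"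
    and gc: "lookup (g b) (c (f b)) = lookup (f b) (c (f b)) - 1"
    and gle: "\<And>i. i \<noteq> z \<Longrightarrow> lookup (g b) i \<le> lookup (f b) i" if "b \<in> ?W" for b
    using cv fA[OF that] unfolding g_def by blast+
  have cpos: "1 \<le> lookup (f b) (c (f b))" and cfirst: "\<And>i. 1 \<le> lookup (f b) i \<Longrightarrow> r (c (f b)) \<le> r i"
    if "b \<in> ?W" for b
    using cv fA[OF that] by blast+
  have f_le: "exp_le (f b) b" for b unfolding f_def by (rule exp_le_diff)
  have g_le: "exp_le (g b) b" if b: "b \<in> ?W" for b
    unfolding exp_le_def using look[OF b] gz[OF b] gle[OF b] by simp
  define h where "h = (Abs_poly_mapping (\<lambda>_. Suc s) :: 'n \<Rightarrow>\<^sub>0 nat)"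
  have bound: "exp_le b h" if b: "b \<in> ?W" for b
  proof -
    have "lookup (f b) i \<le> s" for i
      using minimal_symbolic_exps_bounded[OF s1] fA[OF b] AU by blast
    then have "lookup b i \<le> Suc s" for i unfolding look[OF b, of i] by (simp add: le_SucI)
    then show ?thesis unfolding exp_le_def h_def by simp
  qed

  have lcm: "mon b = monomial_lcm {mon (f b), mon (g b) :: ('n, 'k) mpoly}" if b: "b \<in> ?W" for b
  proof -
    have "exp_le b w" if w: "exp_le (f b) w" "exp_le (g b) w" for w
      unfolding exp_le_def
    proof
      fix i show "lookup b i \<le> lookup w i"
        using w look[OF b, of i] gz[OF b] unfolding exp_le_def by metis
    qed
    then have "is_exp_lub {f b, g b} b"
      unfolding is_exp_lub_def using f_le g_le[OF b] by blast
    from monomial_lcm_eq[OF this, where 'k = 'k, symmetric] show ?thesis by simp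
  qed

  have strict: "strictly_divides (monomial_lcm (\<phi> ` S)) (monomial_lcm S) \<and>
      strictly_divides (monomial_lcm (\<psi> ` S)) (monomial_lcm S)"
    if S: "S \<noteq> {}" "S \<subseteq> mon ` ?W" for S :: "('n, 'k) mpoly set"
  proof -
    obtain B where B: "B \<subseteq> ?W" "S = mon ` B" using S(2) by (rule subset_imageE)
    have \<phi>S: "\<phi> ` S = mon ` f ` B" and \<psi>S: "\<psi> ` S = mon ` g ` B"
      unfolding B(2) image_image \<phi> \<psi> by (rule refl)+
    obtain b where b: "b \<in> B" using S(1) B(2) by blast
    have bW: "d \<in> ?W" if "d \<in> B" for d using that B(1) by blast
    have "strictly_divides (monomial_lcm (mon ` f ` B)) (monomial_lcm (mon ` B) :: ('n, 'k) mpoly)"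
      using b
    proof (rule strictly_divides_lcm)
      show "1 \<le> lookup b z" using look[OF bW[OF b], of z] by simp
      show "exp_le d h" if "d \<in> B" for d using bound bW that by blast
      show "lookup (f d) z \<le> lookup d z - 1" if "d \<in> B" for d using fz[OF bW[OF that]] by simp
    qed (rule f_le)
    moreover
    \<comment> \<open>The member a has the earliest first variable among all members of B; the lcm drops in that variable.\<close>
    obtain a where a: "a \<in> B" "\<And>d. d \<in> B \<Longrightarrow> r (c (f a)) \<le> r (c (f d))"
      using ex_has_least_nat[of "\<lambda>d. d \<in> B" b "\<lambda>d. r (c (f d))"] b by blast
    let ?c = "c (f a)"
    have cz: "?c \<noteq> z" using cpos[OF bW[OF a(1)]] fz[OF bW[OF a(1)]] by auto
    have "strictly_divides (monomial_lcm (mon ` g ` B)) (monomial_lcm (mon ` B) :: ('n, 'k) mpoly)"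
      using a(1)
    proof (rule strictly_divides_lcm)
      show "1 \<le> lookup a ?c" using look[OF bW[OF a(1)], of ?c] cpos[OF bW[OF a(1)]] cz by simp
      show "exp_le d h" if "d \<in> B" for d using bound bW that by blast
      show "exp_le (g d) d" if "d \<in> B" for d using g_le bW that by blast
      show "lookup (g d) ?c \<le> lookup d ?c - 1" if d: "d \<in> B" for d
      proof (cases "1 \<le> lookup (f d) ?c")
        case True
        then have "r (c (f d)) = r ?c" using cfirst[OF bW[OF d]] a(2)[OF d] by (simp add: le_antisym)
        then have "c (f d) = ?c" using r by (rule injD[rotated])
        then show ?thesis using gc[OF bW[OF d]] look[OF bW[OF d], of ?c] cz by simp
      next
        case False
        then show ?thesis using gle[OF bW[OF d] cz] by simp
      qed
    qed
    ultimately show ?thesis unfolding \<phi>S \<psi>S unfolding B(2) by blast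
  qed

  have \<phi>gen: "\<phi> w \<in> mon ` A" and \<psi>gen: "\<psi> w \<in> mon ` (minimal_exps ?U \<inter> {a. 1 \<le> lookup a z})"
    and w_lcm: "w = monomial_lcm {\<phi> w, \<psi> w}" if w: "w \<in> mon ` ?W" for w :: "('n, 'k) mpoly"
  proof -
    obtain b where b: "b \<in> ?W" "w = mon b" using w by blast
    show "\<phi> w \<in> mon ` A" unfolding b(2) \<phi> using fA[OF b(1)] by (rule imageI)
    have "g b \<in> minimal_exps ?U \<inter> {a. 1 \<le> lookup a z}" using gK[OF b(1)] gz[OF b(1)] by simp
    then show "\<psi> w \<in> mon ` (minimal_exps ?U \<inter> {a. 1 \<le> lookup a z})" unfolding b(2) \<psi> by (rule imageI)
    show "w = monomial_lcm {\<phi> w, \<psi> w}" unfolding b(2) \<phi> \<psi> by (rule lcm[OF b(1)])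
  qed

  show ?thesis
    unfolding EK_splitting_def gensI gensJ gensK gensJK
  proof (intro conjI)
    show "monomial_ideal (spanned_by ?U :: ('n, 'k) mpoly set)"
      by (rule monomial_ideal_spanned_by) (rule upU)
    show "monomial_ideal (spanned_by (up_closure A) :: ('n, 'k) mpoly set)"
      by (rule monomial_ideal_spanned_by) (rule upJ)
    show "monomial_ideal (spanned_by K :: ('n, 'k) mpoly set)"
      by (rule monomial_ideal_spanned_by) (rule upK)
    show "mon ` minimal_exps ?U = mon ` A \<union> (mon ` (minimal_exps ?U \<inter> {a. 1 \<le> lookup a z}) :: ('n, 'k) mpoly set)"
      unfolding image_Un[symmetric] using split by (rule arg_cong)
    show "mon ` A \<inter> mon ` (minimal_exps ?U \<inter> {a. 1 \<le> lookup a z}) = ({} :: ('n, 'k) mpoly set)"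
      by (auto simp: A_def)
    show "spanned_by ?U = (spanned_by (up_closure A) <+>\<^bsub>mpoly_ring\<^esub> spanned_by K :: ('n, 'k) mpoly set)"
      by (rule sum)
    show "\<exists>\<phi> \<psi>. (\<forall>w\<in>mon ` ?W. \<phi> w \<in> mon ` A \<and> \<psi> w \<in> mon ` (minimal_exps ?U \<inter> {a. 1 \<le> lookup a z})) \<and>
      (\<forall>w\<in>mon ` ?W. w = monomial_lcm {\<phi> w, \<psi> w}) \<and>
      (\<forall>S. S \<noteq> {} \<and> S \<subseteq> (mon ` ?W :: ('n, 'k) mpoly set) \<longrightarrow>
        strictly_divides (monomial_lcm (\<phi> ` S)) (monomial_lcm S) \<and>
        strictly_divides (monomial_lcm (\<psi> ` S)) (monomial_lcm S))"
    proof (rule exI[of _ \<phi>], rule exI[of _ \<psi>], intro conjI)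
      show "\<forall>w\<in>mon ` ?W. \<phi> w \<in> mon ` A \<and> \<psi> w \<in> mon ` (minimal_exps ?U \<inter> {a. 1 \<le> lookup a z})"
        by (intro ballI conjI) (erule \<phi>gen, erule \<psi>gen)
      show "\<forall>w\<in>mon ` ?W. w = monomial_lcm {\<phi> w, \<psi> w}"
        by (intro ballI) (rule w_lcm)
      show "\<forall>S. S \<noteq> {} \<and> S \<subseteq> (mon ` ?W :: ('n, 'k) mpoly set) \<longrightarrow>
        strictly_divides (monomial_lcm (\<phi> ` S)) (monomial_lcm S) \<and>
        strictly_divides (monomial_lcm (\<psi> ` S)) (monomial_lcm S)"
        by (intro allI impI, elim conjE) (rule strict)
    qed
  qed
qed

theorem corollary3p7:
  fixes m s :: nat
    and x :: "nat \<Rightarrow> 'n::finite"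
    and G :: "'n set set"
    and Is I_H I_GH :: "('n, 'k::field) mpoly set"
  assumes "m \<ge> 3" and "s \<ge> 2"
    and "bij_betw x {1..m} UNIV"
    and "G = complete_graph_edges (x ` {1..m})"
    and "Is = symbolic_power mpoly_ring (edge_ideal G) s"
    and "I_H = Idl\<^bsub>mpoly_ring\<^esub> {w \<in> min_gens Is. \<not> mvar (x m) dvd w}"
    and "I_GH = Is \<inter> Idl\<^bsub>mpoly_ring\<^esub> {mvar (x m)}"
  shows "EK_splitting Is I_H I_GH"
proof -
  let ?A = "minimal_exps (symbolic_exps s) \<inter> {a. lookup a (x m) = 0}"
  have "G = complete_graph_edges UNIV"
    using assms(3,4) by (simp add: bij_betw_def)
  then have Is: "Is = spanned_by (symbolic_exps s)"
    using assms(5) symbolic_power_complete_graph by metis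
  have "min_gens Is = mon ` minimal_exps (symbolic_exps s)"
    unfolding Is using symbolic_exps_up_closed by (rule min_gens_spanned_by)
  then have "{w \<in> min_gens Is. \<not> mvar (x m) dvd w} = mon ` ?A"
    by (auto simp: mvar_eq_mon mon_dvd_mon_iff unit_exp_le_iff)
  then have "I_H = spanned_by (up_closure ?A)"
    unfolding assms(6) by (simp add: Idl_monomials)
  moreover have "I_GH = spanned_by (symbolic_exps s \<inter> {a. 1 \<le> lookup a (x m)})"
    unfolding assms(7) Is multiple_of_variable_ideal by (rule spanned_by_Int)
  ultimately show ?thesis
    unfolding Is using EK_splitting_symbolic_exps[OF assms(2)] by simp
qed

end
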